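(* Let $\delta$ be a locally nilpotent derivation of $\mathbb{C}[x_1,\ldots,x_n]$ that defines a free action of $(\mathbb{C},+)$ on $\mathbb{C}^n$ of degree $d$, and let $x\in\mathbb{C}^n$. If $\mathbb{C}.x$ is a generic orbit (i.e. $(\delta^d x_j)(x)\neq 0$ for at least one $j\in\{1,\ldots,n\}$), then the Chow point $p(x)$ of the projective curve $C_x=\overline{\mathbb{C}.x}\subset\mathbb{P}_n\mathbb{C}$ is the class of the polynomial $$P(x)=\det\bigl(F_{lk}(x)\bigr)_{1\le l\le d,\;0\le k\le d-1},$$ where, for $l,k\in\{0,\ldots,d\}$, $$F_{lk}(x)=\sum_{r=0}^{\min\{d-l,k\}} f_{l+r,\,k-r}(x)\prod_{j=0}^{d-l-r-1}(d-j)\prod_{j=0}^{r-1}(k-j),$$ $$f_{lk}(x)=\sum_{j=0}^n\beta_j(\delta^lx_j)(x)\sum_{j=0}^n\alpha_j(\delta^kx_j)(x)-\sum_{j=0}^n\alpha_j(\delta^lx_j)(x)\sum_{j=0}^n\beta_j(\delta^kx_j)(x).$$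
   Context: Conventions: $x_1,\ldots,x_n$ are the coordinates on $X=\mathbb{C}^n$, and $x_0:=1$ (so $\delta^0x_0=1$ and $\delta^l x_0=0$ for $l>0$). $\delta^0$ is the identity, empty products equal $1$. $X$ is embedded in $\mathbb{P}_n\mathbb{C}$ (homogeneous coordinates $X_0,\ldots,X_n$) by $x\mapsto[1:x_1(x):\ldots:x_n(x)]$. A locally nilpotent derivation $\delta$ of $\mathbb{C}[X]=\mathbb{C}[x_1,\ldots,x_n]$ defines an algebraic action of $(\mathbb{C},+)$ on $X$ by $x_k(-t.x)=\sum_{j\ge 0}\frac{t^j}{j!}(\delta^jx_k)(x)$ for $t\in\mathbb{C}$, $x\in X$, $k=1,\dots,n$. The degree of $\delta$ (and of the action) is the smallest $d$ such that $\delta^{d+1}(x_j)=0$ for all $j$. $C_x$ denotes the closure in $\mathbb{P}_n\mathbb{C}$ of the orbit $\mathbb{C}.x$. Chow point: let $\alpha_0,\ldots,\alpha_n$ and $\beta_0,\ldots,\beta_n$ be two sets of variables (homogeneous coordinates on the two factors of $\mathbb{P}_n\mathbb{C}\times\mathbb{P}_n\mathbb{C}$), and for $\alpha\in\mathbb{P}_n\mathbb{C}$ let $H_\alpha=\{\sum_{j=0}^n\alpha_jX_j=0\}\subset\mathbb{P}_n\mathbb{C}$. The Chow point of an irreducible projective curve $C\subset\mathbb{P}_n\mathbb{C}$ of degree $d$ is the bihomogeneous polynomial of bidegree $(d,d)$ in $(\alpha,\beta)$, determined up to a nonzero scalar, that defines the hypersurface $H_C=\bigcup_{y\in C}\{(\alpha,\beta):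 y\in H_\alpha\cap H_\beta\}\subset\mathbb{P}_n\mathbb{C}\times\mathbb{P}_n\mathbb{C}$; it is regarded as an element of the projectivization of the vector space of bihomogeneous polynomials of bidegree $(d,d)$. The closure of a generic orbit is a curve of degree $d$. *)

theory Defs
  imports Complex_Main "HOL-Library.Poly_Mapping" "Jordan_Normal_Form.Determinant"
begin

section \<open>Polynomials with complex coefficients\<close>

text \<open>The ring structure (convolution product) is the one of the library type of finitely
  supported functions; exponent vectors are finitely supported functions into \<^typ>\<open>nat\<close>.\<close>

type_synonym 'v cpoly = "('v \<Rightarrow>\<^sub>0 nat) \<Rightarrow>\<^sub>0 complex"

definition cconst :: "complex \<Rightarrow> 'v cpoly" where
  "cconst c = Poly_Mapping.single 0 c"

definition cvar :: "'v \<Rightarrow> 'v cpoly" where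
  "cvar i = Poly_Mapping.single (Poly_Mapping.single i 1) 1"

definition ceval :: "('v::finite \<Rightarrow> complex) \<Rightarrow> 'v cpoly \<Rightarrow> complex" where
  "ceval x p = (\<Sum>m\<in>Poly_Mapping.keys p.
     Poly_Mapping.lookup p m * (\<Prod>i\<in>UNIV. x i ^ Poly_Mapping.lookup m i))"

definition homogeneous :: "nat \<Rightarrow> ('v::finite) cpoly \<Rightarrow> bool" where
  "homogeneous k p \<longleftrightarrow>
     (\<forall>m\<in>Poly_Mapping.keys p. (\<Sum>i\<in>UNIV. Poly_Mapping.lookup m i) = k)"

definition bihomogeneous :: "nat \<Rightarrow> nat \<Rightarrow> ('v::finite + 'w::finite) cpoly \<Rightarrow> bool" where
  "bihomogeneous k l p \<longleftrightarrow>
     (\<forall>m\<in>Poly_Mapping.keys p.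
        (\<Sum>i\<in>UNIV. Poly_Mapping.lookup m (Inl i)) = k \<and>
        (\<Sum>i\<in>UNIV. Poly_Mapping.lookup m (Inr i)) = l)"

definition cpoly_class :: "'v cpoly \<Rightarrow> 'v cpoly set" where
  "cpoly_class p = {cconst c * p |c. c \<noteq> 0}"


section \<open>Projective space\<close>

text \<open>A point of the projective space with homogeneous coordinates indexed by \<open>'v\<close> is the
  set of all its vectors of homogeneous coordinates.\<close>

type_synonym 'v ppoint = "('v \<Rightarrow> complex) set"

definition proj_pt :: "('v \<Rightarrow> complex) \<Rightarrow> 'v ppoint" where
  "proj_pt v = {(\<lambda>i. c * v i) |c. c \<noteq> 0}"

definition proj_space :: "('v::finite) ppoint set" where
  "proj_space = {proj_pt v |v. v \<noteq> (\<lambda>_. 0)}"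

definition proj_zeros :: "('v::finite) cpoly set \<Rightarrow> 'v ppoint set" where
  "proj_zeros S = {y \<in> proj_space. \<forall>p\<in>S. \<forall>v\<in>y. ceval v p = 0}"

definition zariski_closed :: "('v::finite) ppoint set \<Rightarrow> bool" where
  "zariski_closed Z \<longleftrightarrow> (\<exists>S. (\<forall>p\<in>S. \<exists>k. homogeneous k p) \<and> Z = proj_zeros S)"

definition irreducible_closed :: "('v::finite) ppoint set \<Rightarrow> bool" where
  "irreducible_closed Z \<longleftrightarrow> zariski_closed Z \<and> Z \<noteq> {} \<and>
     (\<forall>A B. zariski_closed A \<and> zariski_closed B \<and> Z \<subseteq> A \<union> B \<longrightarrow> Z \<subseteq> A \<or> Z \<subseteq> B)"

text \<open>Irreducible closed of Krull dimension one: the longest chains of irreducible closed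
  subsets have exactly two members.\<close>

definition irreducible_curve :: "('v::finite) ppoint set \<Rightarrow> bool" where
  "irreducible_curve C \<longleftrightarrow> irreducible_closed C \<and>
     (\<exists>Z. irreducible_closed Z \<and> Z \<subset> C) \<and>
     \<not> (\<exists>Y Z. irreducible_closed Y \<and> irreducible_closed Z \<and> Y \<subset> Z \<and> Z \<subset> C)"

definition hyperplane :: "('v::finite) ppoint \<Rightarrow> 'v ppoint set" where
  "hyperplane \<alpha> = {y \<in> proj_space. \<forall>a\<in>\<alpha>. \<forall>v\<in>y. (\<Sum>j\<in>UNIV. a j * v j) = 0}"

text \<open>The degree of a curve is the number of points in which a generic hyperplane meets it;
  generic means outside a proper hypersurface \<open>G = 0\<close> of the dual projective space.\<close>

definition has_degree :: "('v::finite) ppoint set \<Rightarrow> nat \<Rightarrow> bool" where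
  "has_degree C d \<longleftrightarrow> (\<exists>G k. homogeneous k G \<and> G \<noteq> 0 \<and>
     (\<forall>\<alpha>\<in>proj_space - proj_zeros {G}.
        finite (C \<inter> hyperplane \<alpha>) \<and> card (C \<inter> hyperplane \<alpha>) = d))"


section \<open>Chow points of curves\<close>

text \<open>The variables \<open>\<alpha>\<^sub>j\<close> and \<open>\<beta>\<^sub>j\<close> are indexed by \<open>Inl j\<close> and \<open>Inr j\<close>.\<close>

definition biproj_zeros :: "('v::finite + 'v) cpoly \<Rightarrow> ('v ppoint \<times> 'v ppoint) set" where
  "biproj_zeros Q = {(\<alpha>, \<beta>) \<in> proj_space \<times> proj_space.
     \<forall>a\<in>\<alpha>. \<forall>b\<in>\<beta>. ceval (case_sum a b) Q = 0}"

definition chow_hypersurface :: "('v::finite) ppoint set \<Rightarrow> ('v ppoint \<times> 'v ppoint) set" where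
  "chow_hypersurface C = (\<Union>y\<in>C. {(\<alpha>, \<beta>) \<in> proj_space \<times> proj_space.
     y \<in> hyperplane \<alpha> \<inter> hyperplane \<beta>})"

text \<open>All bihomogeneous equations of the right bidegree; for an irreducible curve this set is
  a single \<^const>\<open>cpoly_class\<close>, i.e. a point of the projectivized space of polynomials.\<close>

definition chow_point :: "('v::finite) ppoint set \<Rightarrow> ('v + 'v) cpoly set" where
  "chow_point C = {Q. irreducible_curve C \<and> Q \<noteq> 0 \<and>
     (\<exists>d. has_degree C d \<and> bihomogeneous d d Q) \<and> biproj_zeros Q = chow_hypersurface C}"


section \<open>Locally nilpotent derivations and their actions\<close>

definition derivation :: "('n cpoly \<Rightarrow> 'n cpoly) \<Rightarrow> bool" where
  "derivation \<delta> \<longleftrightarrow>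
     (\<forall>p q. \<delta> (p + q) = \<delta> p + \<delta> q) \<and>
     (\<forall>c p. \<delta> (cconst c * p) = cconst c * \<delta> p) \<and>
     (\<forall>p q. \<delta> (p * q) = \<delta> p * q + p * \<delta> q)"

definition locally_nilpotent :: "('n cpoly \<Rightarrow> 'n cpoly) \<Rightarrow> bool" where
  "locally_nilpotent \<delta> \<longleftrightarrow> (\<forall>p. \<exists>m. (\<delta> ^^ m) p = 0)"

definition lnd_degree :: "('n::finite cpoly \<Rightarrow> 'n cpoly) \<Rightarrow> nat" where
  "lnd_degree \<delta> = (LEAST d. \<forall>j. (\<delta> ^^ (d + 1)) (cvar j) = 0)"

text \<open>The sign comes from the convention
  \<open>x\<^sub>k(-t.x) = (\<Sum>j. t ^ j / j! * (\<delta> ^^ j) x\<^sub>k (x))\<close>; the series has finitely many nonzero terms.\<close>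

definition lnd_action ::
  "('n::finite cpoly \<Rightarrow> 'n cpoly) \<Rightarrow> complex \<Rightarrow> ('n \<Rightarrow> complex) \<Rightarrow> ('n \<Rightarrow> complex)" where
  "lnd_action \<delta> t x = (\<lambda>k. suminf (\<lambda>j. (- t) ^ j / fact j * ceval x ((\<delta> ^^ j) (cvar k))))"

definition free_action :: "(complex \<Rightarrow> ('n \<Rightarrow> complex) \<Rightarrow> ('n \<Rightarrow> complex)) \<Rightarrow> bool" where
  "free_action act \<longleftrightarrow> (\<forall>t x. act t x = x \<longrightarrow> t = 0)"

text \<open>The index set \<open>{0, \<dots>, n}\<close> is \<open>'n option\<close>, with \<^const>\<open>None\<close> in the role of \<open>0\<close>.\<close>

definition affine_embed :: "('n::finite \<Rightarrow> complex) \<Rightarrow> 'n option ppoint" where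
  "affine_embed x = proj_pt (case_option 1 x)"

definition orbit_closure ::
  "('n::finite cpoly \<Rightarrow> 'n cpoly) \<Rightarrow> ('n \<Rightarrow> complex) \<Rightarrow> 'n option ppoint set" where
  "orbit_closure \<delta> x = zariski_closed hull (affine_embed ` range (\<lambda>t. lnd_action \<delta> t x))"


section \<open>The determinantal polynomial\<close>

definition coord :: "'n option \<Rightarrow> 'n cpoly" where
  "coord = case_option 1 cvar"

definition alpha_form ::
  "('n::finite cpoly \<Rightarrow> 'n cpoly) \<Rightarrow> ('n \<Rightarrow> complex) \<Rightarrow> nat \<Rightarrow> ('n option + 'n option) cpoly" where
  "alpha_form \<delta> x l = (\<Sum>j\<in>UNIV. cvar (Inl j) * cconst (ceval x ((\<delta> ^^ l) (coord j))))"

definition beta_form ::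
  "('n::finite cpoly \<Rightarrow> 'n cpoly) \<Rightarrow> ('n \<Rightarrow> complex) \<Rightarrow> nat \<Rightarrow> ('n option + 'n option) cpoly" where
  "beta_form \<delta> x l = (\<Sum>j\<in>UNIV. cvar (Inr j) * cconst (ceval x ((\<delta> ^^ l) (coord j))))"

definition f_entry ::
  "('n::finite cpoly \<Rightarrow> 'n cpoly) \<Rightarrow> ('n \<Rightarrow> complex) \<Rightarrow> nat \<Rightarrow> nat \<Rightarrow> ('n option + 'n option) cpoly"
  where
  "f_entry \<delta> x l k = beta_form \<delta> x l * alpha_form \<delta> x k - alpha_form \<delta> x l * beta_form \<delta> x k"

definition F_entry ::
  "('n::finite cpoly \<Rightarrow> 'n cpoly) \<Rightarrow> nat \<Rightarrow> ('n \<Rightarrow> complex) \<Rightarrow> nat \<Rightarrow> nat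
     \<Rightarrow> ('n option + 'n option) cpoly" where
  "F_entry \<delta> d x l k = (\<Sum>r\<in>{0..min (d - l) k}.
     f_entry \<delta> x (l + r) (k - r) *
     of_nat (\<Prod>j<d - l - r. d - j) * of_nat (\<Prod>j<r. k - j))"

text \<open>Matrix indices start at \<open>0\<close>, so row \<open>i\<close> is the row \<open>l = i + 1\<close>.\<close>

definition P_poly ::
  "('n::finite cpoly \<Rightarrow> 'n cpoly) \<Rightarrow> nat \<Rightarrow> ('n \<Rightarrow> complex) \<Rightarrow> ('n option + 'n option) cpoly" where
  "P_poly \<delta> d x = det (mat d d (\<lambda>(i, k). F_entry \<delta> d x (i + 1) k))"

end

theory Submission
  imports Defs "HOL-Computational_Algebra.Fundamental_Theorem_Algebra"
begin

text \<open>In homogeneous coordinates the orbit of \<open>x\<close> is the polynomial curve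
  \<open>\<gamma>(t) = (\<Sum>l\<le>d. t\<^sup>l / l! v\<^sub>l)\<close> with \<open>v\<^sub>l = ((\<delta>\<^sup>l x\<^sub>j)(x))\<^sub>j\<close>, and its closure adds the single point
  \<open>[v\<^sub>d]\<close>. The hyperplanes \<open>\<alpha>\<close> and \<open>\<beta>\<close> meet on the closure iff the polynomials \<open>\<alpha> \<cdot> \<gamma>\<close> and
  \<open>\<beta> \<cdot> \<gamma>\<close>, taken as forms of degree \<open>d\<close>, have a common zero on the projective line. Up to the
  nonzero factors \<open>d! k!\<close> the entries \<open>F\<^sub>l\<^sub>k\<close> are those of the Bezout matrix of the two polynomials,
  so \<open>P(x)\<close> vanishes exactly on the Chow hypersurface. Conversely let \<open>Q\<close> be another equation of
  bidegree \<open>(d, d)\<close>. For generic \<open>\<alpha>\<close> the polynomial \<open>\<alpha> \<cdot> \<gamma>\<close> has \<open>d\<close> simple zeros, so on a generic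
  line of \<open>\<beta>\<close>'s both \<open>P\<close> and \<open>Q\<close> have degree at most \<open>d\<close> and \<open>d\<close> common zeros. Hence they are
  proportional as functions of \<open>\<beta>\<close>, likewise as functions of \<open>\<alpha>\<close>, and therefore altogether.\<close>

subsection \<open>Evaluation of polynomials\<close>

lemma poly_mapping_sum_singles:
  "p = (\<Sum>m\<in>Poly_Mapping.keys p. Poly_Mapping.single m (Poly_Mapping.lookup p m))"
  by (rule poly_mapping_eqI)
    (auto simp: lookup_sum lookup_single when_def sum.delta' in_keys_iff)

lemma cpoly_induct [case_names single add]:
  fixes p :: "'a \<Rightarrow>\<^sub>0 'b::comm_monoid_add"
  assumes single: "\<And>m c. P (Poly_Mapping.single m c)"
    and add: "\<And>p q. P p \<Longrightarrow> P q \<Longrightarrow> P (p + q)"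
  shows "P p"
proof -
  have "P (\<Sum>m\<in>A. Poly_Mapping.single m (Poly_Mapping.lookup p m))" if "finite A" for A
    using that
  proof (induction A rule: finite_induct)
    case empty
    \<comment> \<open>The zero polynomial falls under the monomial case, with coefficient 0.\<close>
    show ?case using single[of undefined 0] by simp
  next
    case (insert m A)
    then show ?case by (simp add: add single)
  qed
  then show ?thesis by (subst poly_mapping_sum_singles) simp
qed

lemma ceval_superset:
  assumes "finite A" "Poly_Mapping.keys p \<subseteq> A"
  shows "ceval x p =
    (\<Sum>m\<in>A. Poly_Mapping.lookup p m * (\<Prod>i\<in>UNIV. x i ^ Poly_Mapping.lookup m i))"
  unfolding ceval_def using assms
  by (intro sum.mono_neutral_left) (auto simp: in_keys_iff)

lemma ceval_single:
  "ceval x (Poly_Mapping.single m c) = c * (\<Prod>i\<in>UNIV. x i ^ Poly_Mapping.lookup m i)"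
  by (subst ceval_superset[of "{m}"]) auto

lemma ceval_add: "ceval x (p + q) = ceval x p + ceval x q"
proof -
  let ?A = "Poly_Mapping.keys p \<union> Poly_Mapping.keys q"
  have "Poly_Mapping.keys (p + q) \<subseteq> ?A" by (rule keys_add)
  then show ?thesis
    by (simp add: ceval_superset[of ?A] lookup_add sum.distrib algebra_simps)
qed

lemma ceval_mult: "ceval x (p * q) = ceval x p * ceval x q"
proof (induction p rule: cpoly_induct)
  case (single m c)
  show ?case
  proof (induction q rule: cpoly_induct)
    case (single m' c')
    show ?case
      by (simp add: mult_single ceval_single lookup_add power_add prod.distrib algebra_simps)
  next
    case (add p q)
    then show ?case by (simp add: distrib_left ceval_add)
  qed
next
  case (add p q)
  then show ?case by (simp add: distrib_right ceval_add)
qed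

lemma ceval_cconst [simp]: "ceval x (cconst c) = c"
  by (simp add: cconst_def ceval_single)

lemma ceval_cvar [simp]: "ceval x (cvar i) = x i"
proof -
  have "(\<Prod>j\<in>UNIV. x j ^ Poly_Mapping.lookup (Poly_Mapping.single i (1::nat)) j) =
      (\<Prod>j\<in>UNIV. if j = i then x j else 1)"
    by (intro prod.cong) (auto simp: lookup_single when_def)
  then show ?thesis by (simp add: cvar_def ceval_single)
qed

interpretation ceval: comm_ring_hom "ceval x"
proof
  show "ceval x 1 = 1"
    using ceval_cconst[of x 1] by (simp add: cconst_def)
  show "ceval x 0 = 0" by (simp add: ceval_def)
qed (auto simp: ceval_add ceval_mult)

text \<open>Universal property of the polynomial ring: monomials are products of constants and
  variables. It will identify p \<mapsto> p(-t.x) as evaluation at a point.\<close>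

lemma ring_hom_eq_ceval:
  fixes h :: "('v::finite) cpoly \<Rightarrow> complex"
  assumes "comm_ring_hom h" and const: "\<And>c. h (cconst c) = c"
  shows "h p = ceval (\<lambda>i. h (cvar i)) p"
proof -
  interpret h: comm_ring_hom h by fact
  have var_pow: "Poly_Mapping.single (Poly_Mapping.single i k) 1 = cvar i ^ k" for i :: 'v and k
  proof (induction k)
    case 0
    show ?case by simp
  next
    case (Suc k)
    have "Poly_Mapping.single i (Suc k) = Poly_Mapping.single i 1 + Poly_Mapping.single i k"
      by (simp flip: single_add)
    then show ?case using Suc mult_single[of "Poly_Mapping.single i 1" 1 "Poly_Mapping.single i k" "1::complex"]
      by (simp add: cvar_def)
  qed
  have monom: "Poly_Mapping.single (\<Sum>i\<in>A. Poly_Mapping.single i (e i)) 1 = (\<Prod>i\<in>A. cvar i ^ e i)"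
    if "finite A" for A :: "'v set" and e
    using that
  proof (induction A rule: finite_induct)
    case (insert i A)
    then show ?case
      using mult_single[of "Poly_Mapping.single i (e i)" 1 "\<Sum>i\<in>A. Poly_Mapping.single i (e i)" "1::complex"]
      by (simp add: var_pow)
  qed simp
  show ?thesis
  proof (induction p rule: cpoly_induct)
    case (single m c)
    have m: "m = (\<Sum>i\<in>UNIV. Poly_Mapping.single i (Poly_Mapping.lookup m i))"
      by (rule poly_mapping_eqI) (simp add: lookup_sum lookup_single when_def)
    have "Poly_Mapping.single m c = cconst c * Poly_Mapping.single m 1"
      by (simp add: cconst_def mult_single)
    also have "Poly_Mapping.single m 1 = (\<Prod>i\<in>UNIV. cvar i ^ Poly_Mapping.lookup m i)"
      by (subst m) (simp only: monom finite)
    finally have *: "Poly_Mapping.single m c = cconst c * (\<Prod>i\<in>UNIV. cvar i ^ Poly_Mapping.lookup m i)" .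
    show ?case
      unfolding * by (simp add: h.hom_mult h.hom_prod h.hom_power const ceval.hom_mult
          ceval.hom_prod ceval.hom_power)
  next
    case (add p q)
    then show ?case by (simp add: h.hom_add ceval_add)
  qed
qed

text \<open>The degree is bounded monomial by monomial, so that partial homogeneity can later bound
  the degree along lines in one group of variables.\<close>

lemma ceval_poly_curve:
  fixes c :: "'v::finite \<Rightarrow> complex poly"
  assumes "\<And>m. m \<in> Poly_Mapping.keys p \<Longrightarrow>
    (\<Sum>i\<in>UNIV. Poly_Mapping.lookup m i * degree (c i)) \<le> D"
  obtains r where "degree r \<le> D" "\<And>t. ceval (\<lambda>i. poly (c i) t) p = poly r t"
proof
  let ?r = "\<Sum>m\<in>Poly_Mapping.keys p.
    smult (Poly_Mapping.lookup p m) (\<Prod>i\<in>UNIV. c i ^ Poly_Mapping.lookup m i)"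
  show "degree ?r \<le> D"
  proof (intro degree_sum_le finite_keys)
    fix m assume m: "m \<in> Poly_Mapping.keys p"
    have "degree (\<Prod>i\<in>UNIV. c i ^ Poly_Mapping.lookup m i) \<le>
        (\<Sum>i\<in>UNIV. degree (c i ^ Poly_Mapping.lookup m i))"
      by (rule order_trans[OF degree_prod_sum_le]) auto
    also have "\<dots> \<le> (\<Sum>i\<in>UNIV. Poly_Mapping.lookup m i * degree (c i))"
      by (intro sum_mono) (metis degree_power_le mult.commute)
    also have "\<dots> \<le> D" by (rule assms) (rule m)
    finally show "degree (smult (Poly_Mapping.lookup p m)
        (\<Prod>i\<in>UNIV. c i ^ Poly_Mapping.lookup m i)) \<le> D"
      by (rule order_trans[OF degree_smult_le])
  qed
  show "ceval (\<lambda>i. poly (c i) t) p = poly ?r t" for t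
    by (simp add: ceval_def poly_sum poly_prod poly_power)
qed

lemma ceval_poly_curve_ex:
  fixes c :: "'v::finite \<Rightarrow> complex poly"
  obtains r where "\<And>t. ceval (\<lambda>i. poly (c i) t) p = poly r t"
\<comment> \<open>Any bound on the degree will do here; the sum over all monomials is one.\<close>
proof (rule ceval_poly_curve[of p c "\<Sum>m\<in>Poly_Mapping.keys p. \<Sum>i\<in>UNIV. Poly_Mapping.lookup m i * degree (c i)"])
  fix m assume "m \<in> Poly_Mapping.keys p"
  then show "(\<Sum>i\<in>UNIV. Poly_Mapping.lookup m i * degree (c i)) \<le>
      (\<Sum>m\<in>Poly_Mapping.keys p. \<Sum>i\<in>UNIV. Poly_Mapping.lookup m i * degree (c i))"
    by (intro member_le_sum) auto
qed (use that in blast)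

text \<open>Uniqueness of digits in base \<open>N\<close>: the lowest digit is read off modulo
  \<open>N\<close>, the others after division by \<open>N\<close>.\<close>

lemma base_expansion_inj:
  fixes f g :: "nat \<Rightarrow> nat"
  assumes "\<And>i. i < n \<Longrightarrow> f i < N" "\<And>i. i < n \<Longrightarrow> g i < N"
    and "(\<Sum>i<n. f i * N ^ i) = (\<Sum>i<n. g i * N ^ i)" and "i < n"
  shows "f i = g i"
  using assms
proof (induction n arbitrary: f g i)
  case (Suc n)
  have N: "N > 0" using Suc.prems(1)[of 0] by simp
  have split: "(\<Sum>i<Suc n. h i * N ^ i) = h 0 + N * (\<Sum>i<n. h (Suc i) * N ^ i)" for h :: "nat \<Rightarrow> nat"
    by (simp only: sum.lessThan_Suc_shift) (simp add: sum_distrib_left algebra_simps)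
  have eq: "f 0 + N * (\<Sum>i<n. f (Suc i) * N ^ i) = g 0 + N * (\<Sum>i<n. g (Suc i) * N ^ i)"
    using Suc.prems(3) unfolding split .
  have f0: "f 0 < N" "g 0 < N" using Suc.prems by auto
  have "f 0 = g 0"
    using arg_cong[OF eq, of "\<lambda>z. z mod N"] f0 by simp
  moreover from this eq N have "(\<Sum>i<n. f (Suc i) * N ^ i) = (\<Sum>i<n. g (Suc i) * N ^ i)" by simp
  then have "f (Suc j) = g (Suc j)" if "j < n" for j
    using Suc.IH[of "\<lambda>i. f (Suc i)" "\<lambda>i. g (Suc i)" j] Suc.prems(1,2) that by simp
  ultimately show ?case using Suc.prems(4) by (cases i) auto
qed simp

text \<open>Kronecker substitution: sending the variables to suitable powers of a single one
  keeps the monomials of a given polynomial apart.\<close>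

lemma ceval_nonzero_ex:
  fixes p :: "('v::finite) cpoly"
  assumes "p \<noteq> 0"
  obtains x where "ceval x p \<noteq> 0"
proof -
  obtain e :: "'v \<Rightarrow> nat" and n where e: "bij_betw e UNIV {..<n}"
    using ex_bij_betw_finite_nat[OF finite_UNIV] by (metis atLeast0LessThan)
  let ?K = "Poly_Mapping.keys p"
  \<comment> \<open>\<open>N\<close> exceeds every exponent in \<open>p\<close>, so the exponents of
    a monomial are the base \<open>N\<close> digits of \<open>E m\<close> below.\<close>
  define N where "N = Suc (\<Sum>m\<in>?K. \<Sum>i\<in>UNIV. Poly_Mapping.lookup m i)"
  have bound: "Poly_Mapping.lookup m i < N" if "m \<in> ?K" for m i
  proof -
    have "Poly_Mapping.lookup m i \<le> (\<Sum>i\<in>UNIV. Poly_Mapping.lookup m i)"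
      by (intro member_le_sum) auto
    also have "\<dots> \<le> (\<Sum>m\<in>?K. \<Sum>i\<in>UNIV. Poly_Mapping.lookup m i)"
      using that by (intro member_le_sum) auto
    finally show ?thesis by (simp add: N_def)
  qed
  define E where "E m = (\<Sum>i\<in>UNIV. Poly_Mapping.lookup m i * N ^ e i)" for m :: "'v \<Rightarrow>\<^sub>0 nat"
  have inv': "inv_into UNIV e (e i) = i" for i
    using e by (simp add: bij_betw_def)
  have E: "E m = (\<Sum>k<n. Poly_Mapping.lookup m (inv_into UNIV e k) * N ^ k)" for m
    unfolding E_def
    using sum.reindex_bij_betw[OF e, of "\<lambda>k. Poly_Mapping.lookup m (inv_into UNIV e k) * N ^ k"]
    by (simp add: inv')
  have inj: "inj_on E ?K"
  proof (rule inj_onI, rule poly_mapping_eqI)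
    fix m m' i assume m: "m \<in> ?K" "m' \<in> ?K" "E m = E m'"
    let ?f = "\<lambda>m k. Poly_Mapping.lookup m (inv_into UNIV e k)"
    have "e i < n" using e by (auto simp: bij_betw_def)
    then have "?f m (e i) = ?f m' (e i)"
      using m by (intro base_expansion_inj[of n "?f m" N "?f m'"]) (simp_all add: bound flip: E)
    then show "Poly_Mapping.lookup m i = Poly_Mapping.lookup m' i" by (simp add: inv')
  qed
  let ?r = "\<Sum>m\<in>?K. monom (Poly_Mapping.lookup p m) (E m)"
  have r: "ceval (\<lambda>i. t ^ (N ^ e i)) p = poly ?r t" for t
    by (simp add: ceval_def poly_sum poly_monom E_def power_sum mult.commute flip: power_mult)
  obtain m where m: "m \<in> ?K"
    using assms by (metis ex_in_conv keys_eq_empty)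
  have "coeff ?r (E m) = (\<Sum>m'\<in>?K. if m' = m then Poly_Mapping.lookup p m' else 0)"
    unfolding coeff_sum using inj m by (intro sum.cong) (auto dest: inj_onD)
  also have "\<dots> \<noteq> 0" using m by (simp add: in_keys_iff)
  finally have "?r \<noteq> 0" by force
  then obtain t where "poly ?r t \<noteq> 0"
    using poly_all_0_iff_0 by blast
  then show ?thesis using r that by metis
qed

lemma ceval_ext: "(\<And>x. ceval x p = ceval x q) \<Longrightarrow> p = q"
  by (metis ceval.hom_minus ceval_nonzero_ex right_minus_eq)

subsection \<open>Weighted homogeneous polynomials\<close>

text \<open>The relevant weights are the total degree and the two partial degrees.\<close>

definition homog_wt :: "(('v \<Rightarrow>\<^sub>0 nat) \<Rightarrow> nat) \<Rightarrow> nat \<Rightarrow> 'v cpoly \<Rightarrow> bool" where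
  "homog_wt w k p \<longleftrightarrow> (\<forall>m\<in>Poly_Mapping.keys p. w m = k)"

locale additive_weight =
  fixes w :: "('v \<Rightarrow>\<^sub>0 nat) \<Rightarrow> nat"
  assumes weight_add: "w (m + m') = w m + w m'"
begin

lemma weight_zero: "w 0 = 0"
  using weight_add[of 0 0] by simp

lemma homog_wt_zero: "homog_wt w k 0"
  by (simp add: homog_wt_def)

lemma homog_wt_add: "homog_wt w k p \<Longrightarrow> homog_wt w k q \<Longrightarrow> homog_wt w k (p + q)"
  using keys_add[of p q] by (fastforce simp: homog_wt_def)

lemma homog_wt_diff: "homog_wt w k p \<Longrightarrow> homog_wt w k q \<Longrightarrow> homog_wt w k (p - q)"
  using keys_diff[of p q] by (fastforce simp: homog_wt_def)

lemma homog_wt_sum: "(\<And>i. i \<in> A \<Longrightarrow> homog_wt w k (f i)) \<Longrightarrow> homog_wt w k (sum f A)"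
  by (induction A rule: infinite_finite_induct) (auto simp: homog_wt_zero homog_wt_add)

lemma homog_wt_mult:
  "homog_wt w k p \<Longrightarrow> homog_wt w l q \<Longrightarrow> homog_wt w (k + l) (p * q)"
  using keys_mult[of p q] by (fastforce simp: homog_wt_def weight_add)

lemma homog_wt_cconst: "homog_wt w 0 (cconst c)"
  by (simp add: homog_wt_def cconst_def weight_zero)

lemma homog_wt_of_nat: "homog_wt w 0 (of_nat n)"
  using homog_wt_cconst[of "of_nat n"] by (simp add: cconst_def)

lemma homog_wt_of_int: "homog_wt w 0 (of_int n)"
  using homog_wt_cconst[of "of_int n"] by (simp add: cconst_def)

lemma homog_wt_prod:
  "(\<And>i. i \<in> A \<Longrightarrow> homog_wt w k (f i)) \<Longrightarrow> homog_wt w (card A * k) (prod f A)"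
proof (induction A rule: infinite_finite_induct)
  case (insert i A)
  then show ?case by (simp add: homog_wt_mult)
qed (use homog_wt_of_nat[of 1] in simp_all)

text \<open>By the Leibniz formula each term is a product of \<open>n\<close> entries with a sign of
  weight 0.\<close>

lemma homog_wt_det:
  assumes "\<And>i j. i < n \<Longrightarrow> j < n \<Longrightarrow> homog_wt w k (f (i, j))"
  shows "homog_wt w (n * k) (det (mat n n f))"
proof -
  have "homog_wt w (0 + card {0..<n} * k) (signof p * (\<Prod>i = 0..<n. mat n n f $$ (i, p i)))"
    if "p permutes {0..<n}" for p
  proof (intro homog_wt_mult homog_wt_prod)
    show "homog_wt w 0 (signof p)"
      using homog_wt_of_int[of "sign p"] by simp
    fix i assume "i \<in> {0..<n}"
    moreover from this have "p i < n" using permutes_in_image[OF that, of i] by simp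
    ultimately show "homog_wt w k (mat n n f $$ (i, p i))" using assms by simp
  qed
  then show ?thesis
    by (subst det_def'[where n = n]) (auto intro!: homog_wt_sum)
qed

end

subsection \<open>The Bezout determinant\<close>

text \<open>The pattern of \<open>F_entry\<close> for arbitrary sequences in place of the values of
  the linear forms. The ring is left open so that the determinant can be formed over polynomials and
  then evaluated.\<close>

definition bez_entry :: "nat \<Rightarrow> (nat \<Rightarrow> 'a) \<Rightarrow> (nat \<Rightarrow> 'a) \<Rightarrow> nat \<Rightarrow> nat \<Rightarrow> 'a::comm_ring_1" where
  "bez_entry d a b l k = (\<Sum>r\<in>{0..min (d - l) k}.
     (b (l + r) * a (k - r) - a (l + r) * b (k - r)) *
     of_nat (\<Prod>j<d - l - r. d - j) * of_nat (\<Prod>j<r. k - j))"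

definition bez_det :: "nat \<Rightarrow> (nat \<Rightarrow> 'a) \<Rightarrow> (nat \<Rightarrow> 'a) \<Rightarrow> 'a::comm_ring_1" where
  "bez_det d a b = det (mat d d (\<lambda>(i, k). bez_entry d a b (i + 1) k))"

lemma (in comm_ring_hom) hom_bez_det:
  "hom (bez_det d a b) = bez_det d (\<lambda>l. hom (a l)) (\<lambda>l. hom (b l))"
proof -
  have "map_mat hom (mat d d (\<lambda>(i, k). bez_entry d a b (i + 1) k)) =
      mat d d (\<lambda>(i, k). bez_entry d (\<lambda>l. hom (a l)) (\<lambda>l. hom (b l)) (i + 1) k)"
    by (rule eq_matI) (auto simp: bez_entry_def hom_distribs)
  then show ?thesis by (simp add: bez_det_def flip: hom_det)
qed

text \<open>Every entry is bilinear in the two sequences, hence of weight \<open>i + j\<close>, and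
  there are \<open>d\<close> rows.\<close>

lemma (in additive_weight) homog_wt_bez_det:
  assumes a: "\<And>l. homog_wt w i (a l)" and b: "\<And>l. homog_wt w j (b l)"
  shows "homog_wt w (d * (i + j)) (bez_det d a b)"
  unfolding bez_det_def
proof (rule homog_wt_det)
  fix p q
  have "homog_wt w (i + j) (b l * a k - a l * b k)" for l k
    using homog_wt_mult[OF b[of l] a[of k]] homog_wt_mult[OF a[of l] b[of k]]
    by (simp add: homog_wt_diff add.commute)
  then have "homog_wt w (i + j) ((b (l + r) * a (k - r) - a (l + r) * b (k - r)) *
      of_nat m * of_nat m')" for l r k m m'
    using homog_wt_mult[OF homog_wt_mult[OF _ homog_wt_of_nat] homog_wt_of_nat, of "i + j"] by simp
  then show "homog_wt w (i + j) (case (p, q) of (i, k) \<Rightarrow> bez_entry d a b (i + 1) k)"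
    unfolding bez_entry_def split_conv by (intro homog_wt_sum)
qed

text \<open>The polynomial whose derivatives at \<open>0\<close> are \<open>a 0, \<dots>, a d\<close>.\<close>

definition exp_poly :: "nat \<Rightarrow> (nat \<Rightarrow> complex) \<Rightarrow> complex poly" where
  "exp_poly d a = (\<Sum>j\<le>d. monom (a j / fact j) j)"

lemma coeff_exp_poly: "coeff (exp_poly d a) j = (if j \<le> d then a j / fact j else 0)"
  by (auto simp: exp_poly_def coeff_sum)

lemma poly_exp_poly: "poly (exp_poly d a) t = (\<Sum>j\<le>d. a j / fact j * t ^ j)"
  by (simp add: exp_poly_def poly_sum poly_monom)

lemma degree_exp_poly_le: "degree (exp_poly d a) \<le> d"
  by (rule degree_le) (simp add: coeff_exp_poly)

lemma degree_exp_poly: "a d \<noteq> 0 \<Longrightarrow> degree (exp_poly d a) = d"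
  by (intro antisym degree_exp_poly_le le_degree) (simp add: coeff_exp_poly)

section \<open>Rows of the Bezout matrix as polynomials\<close>

definition exp_poly_tail :: "nat \<Rightarrow> (nat \<Rightarrow> complex) \<Rightarrow> nat \<Rightarrow> complex poly" where
  "exp_poly_tail d a l = poly_shift l (exp_poly d a)"

text \<open>Bezout's construction with the quotients by t^l: every linear combination of rows has
  the form V_b * a - V_a * b, where for l > 0 the factors V_a and V_b have degree below d.\<close>

definition bez_row :: "nat \<Rightarrow> (nat \<Rightarrow> complex) \<Rightarrow> (nat \<Rightarrow> complex) \<Rightarrow> nat \<Rightarrow> complex poly" where
  "bez_row d a b l = exp_poly_tail d b l * exp_poly d a - exp_poly_tail d a l * exp_poly d b"

lemma coeff_exp_poly_tail:
  "coeff (exp_poly_tail d a l) r = (if l + r \<le> d then a (l + r) / fact (l + r) else 0)"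
  by (simp add: exp_poly_tail_def coeff_poly_shift coeff_exp_poly add.commute)

lemma prod_falling_fact:
  assumes "m \<le> n"
  shows "of_nat (\<Prod>j<m. n - j) = (fact n / fact (n - m) :: 'a::field_char_0)"
proof -
  have "(\<Prod>j<m. n - j) * fact (n - m) = (fact n :: nat)"
    using assms
  proof (induction m)
    case (Suc m)
    have "fact (n - m) = (n - m) * (fact (n - Suc m) :: nat)"
      using Suc.prems by (metis Suc_diff_Suc Suc_le_lessD fact_Suc of_nat_id)
    then show ?case using Suc by (simp add: mult.assoc)
  qed simp
  then have "of_nat (\<Prod>j<m. n - j) * fact (n - m) = (fact n :: 'a)"
    by (metis of_nat_fact of_nat_mult)
  then show ?thesis by (simp add: eq_divide_eq del: of_nat_prod)
qed

text \<open>The two products are the falling factorials d!/(l+r)! and k!/(k-r)!. They turn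
  derivatives into Taylor coefficients and leave the factor d! k!; the sum over r is then a
  convolution.\<close>

lemma bez_entry_eq_coeff_bez_row:
  assumes "k < d" "l \<le> d"
  shows "bez_entry d a b l k = fact d * fact k * coeff (bez_row d a b l) k"
proof -
  have *: "coeff (exp_poly_tail d a l * exp_poly d b) k =
      (\<Sum>r\<in>{0..min (d - l) k}. a (l + r) / fact (l + r) * (b (k - r) / fact (k - r)))" for a b
  proof -
    have "coeff (exp_poly_tail d a l * exp_poly d b) k =
      (\<Sum>r\<le>k. if l + r \<le> d then a (l + r) / fact (l + r) * (b (k - r) / fact (k - r)) else 0)"
      unfolding coeff_mult using assms
      by (intro sum.cong) (auto simp: coeff_exp_poly_tail coeff_exp_poly)
    also have "\<dots> = (\<Sum>r\<in>{r\<in>{..k}. l + r \<le> d}. a (l + r) / fact (l + r) * (b (k - r) / fact (k - r)))"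
      by (rule sum.inter_filter[symmetric]) simp
    also have "{r\<in>{..k}. l + r \<le> d} = {0..min (d - l) k}" using assms by auto
    finally show ?thesis .
  qed
  have "bez_entry d a b l k = (\<Sum>r\<in>{0..min (d - l) k}. fact d * fact k *
     (b (l + r) / fact (l + r) * (a (k - r) / fact (k - r))
       - a (l + r) / fact (l + r) * (b (k - r) / fact (k - r))))"
    unfolding bez_entry_def
  proof (rule sum.cong)
    fix r assume r: "r \<in> {0..min (d - l) k}"
    then have "d - (d - l - r) = l + r" using assms by auto
    then have "of_nat (\<Prod>j<d - l - r. d - j) = (fact d / fact (l + r) :: complex)"
      using prod_falling_fact[of "d - l - r" d] by simp
    moreover have "of_nat (\<Prod>j<r. k - j) = (fact k / fact (k - r) :: complex)"
      using prod_falling_fact[of r k] r by simp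
    ultimately show "(b (l + r) * a (k - r) - a (l + r) * b (k - r)) *
       of_nat (\<Prod>j<d - l - r. d - j) * of_nat (\<Prod>j<r. k - j) = fact d * fact k *
       (b (l + r) / fact (l + r) * (a (k - r) / fact (k - r))
       - a (l + r) / fact (l + r) * (b (k - r) / fact (k - r)))"
      by (simp add: field_simps)
  qed simp
  then show ?thesis
    by (simp only: bez_row_def coeff_diff * sum_subtractf[symmetric] sum_distrib_left)
qed

text \<open>The top terms of the two products cancel: only the parts of degree below \<open>l\<close> of the
  second factors contribute.\<close>

lemma coeff_bez_row_eq_0:
  assumes "0 < l" "l \<le> d" "d \<le> k"
  shows "coeff (bez_row d a b l) k = 0"
proof -
  let ?t = "exp_poly_tail d" and ?c = "\<lambda>a. poly_cutoff l (exp_poly d a)"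
  have split: "exp_poly d a = ?c a + monom 1 l * ?t a l" for a
    by (rule poly_eqI) (auto simp: coeff_poly_cutoff coeff_monom_mult coeff_exp_poly_tail
        coeff_exp_poly not_less)
  have row: "bez_row d a b l = ?t b l * ?c a - ?t a l * ?c b"
    unfolding bez_row_def by (subst (1 2) split) (simp add: algebra_simps)
  have "coeff (?t a l * ?c b) k = 0" for a b
  \<comment> \<open>The degrees d - l and l - 1 add up to d - 1, which is below k.\<close>
  proof (rule coeff_eq_0)
    have "degree (?t a l) \<le> d - l"
      using assms by (intro degree_le) (auto simp: coeff_exp_poly_tail)
    moreover have "degree (?c b) \<le> l - 1"
      using assms by (intro degree_le) (auto simp: coeff_poly_cutoff)
    ultimately show "degree (?t a l * ?c b) < k"
      using degree_mult_le[of "?t a l" "?c b"] assms by linarith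
  qed
  then show ?thesis by (simp add: row)
qed

section \<open>Vanishing of the Bezout determinant\<close>

text \<open>Over the complex numbers the absence of common roots means coprimality. The linear
  factors of \<open>p\<close> are split off one at a time; each must divide
  \<open>v\<close>.\<close>

lemma dvd_of_no_common_root:
  fixes p q v :: "complex poly"
  assumes "p dvd v * q" "p \<noteq> 0" "\<And>t. poly p t = 0 \<Longrightarrow> poly q t \<noteq> 0"
  shows "p dvd v"
  using assms
proof (induction "degree p" arbitrary: p v rule: less_induct)
  case less
  show ?case
  proof (cases "degree p = 0")
    case True
    then show ?thesis
      using less.prems by (metis is_unit_iff_degree unit_imp_dvd)
  next
    case False
    then have "\<not> constant (poly p)" by (simp add: constant_degree)
    then obtain t where t: "poly p t = 0" using fundamental_theorem_of_algebra by blast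
    then obtain p' where p': "p = [:-t, 1:] * p'" by (meson dvdE poly_eq_0_iff_dvd)
    have "poly (v * q) t = 0" using t less.prems(1) by (metis dvdE mult_zero_left poly_mult)
    then have "poly v t = 0" using t less.prems(3) by simp
    then obtain v' where v': "v = [:-t, 1:] * v'" by (meson dvdE poly_eq_0_iff_dvd)
    have "p' \<noteq> 0" using p' less.prems(2) by auto
    then have "degree p' < degree p" unfolding p' by (subst degree_mult_eq) auto
    moreover have "p' dvd v' * q"
      using less.prems(1) unfolding p' v' mult.assoc by (subst (asm) dvd_mult_cancel_left) auto
    moreover have "poly q s \<noteq> 0" if "poly p' s = 0" for s
      using less.prems(3) that by (simp add: p')
    ultimately have "p' dvd v'" using less.hyps \<open>p' \<noteq> 0\<close> by blast
    then show ?thesis unfolding p' v' by (rule mult_dvd_mono[OF dvd_refl])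
  qed
qed

text \<open>The rows of the matrix record the coefficients below degree d up to nonzero factors, and
  the higher coefficients vanish; so a relation between the rows is a relation between whole
  polynomials.\<close>

lemma bez_det_0_iff_rows_dependent:
  "bez_det d a b = 0 \<longleftrightarrow> (\<exists>w. (\<exists>i<d. w i \<noteq> 0) \<and> (\<Sum>i<d. smult (w i) (bez_row d a b (i + 1))) = 0)"
proof -
  let ?M = "mat d d (\<lambda>(i, k). bez_entry d a b (i + 1) k)"
  have "bez_det d a b = 0 \<longleftrightarrow>
      (\<exists>v. v \<in> carrier_vec d \<and> v \<noteq> 0\<^sub>v d \<and> ?M\<^sup>T *\<^sub>v v = 0\<^sub>v d)"
    unfolding bez_det_def by (subst det_0_iff_vec_prod_zero[symmetric])
      (auto simp: det_transpose[where n = d])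
  also have "\<dots> \<longleftrightarrow> (\<exists>w. (\<exists>i<d. w i \<noteq> 0) \<and>
      (\<forall>k<d. (\<Sum>i<d. w i * bez_entry d a b (i + 1) k) = 0))" (is "?L \<longleftrightarrow> ?R")
  proof
    assume ?L
    then obtain v where v: "v \<in> carrier_vec d" "v \<noteq> 0\<^sub>v d" "?M\<^sup>T *\<^sub>v v = 0\<^sub>v d" by blast
    have "(\<Sum>i<d. v $ i * bez_entry d a b (i + 1) k) = 0" if "k < d" for k
      using arg_cong[OF v(3), of "\<lambda>u. u $ k"] that v(1)
      by (simp add: scalar_prod_def atLeast0LessThan mult.commute)
    moreover have "\<exists>i<d. v $ i \<noteq> 0"
      using v(1,2) by (metis carrier_vecD eq_vecI index_zero_vec)
    ultimately show ?R by blast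
  next
    assume ?R
    then obtain w where w: "\<exists>i<d. w i \<noteq> 0"
      "\<And>k. k < d \<Longrightarrow> (\<Sum>i<d. w i * bez_entry d a b (i + 1) k) = 0" by blast
    have "vec d w \<noteq> 0\<^sub>v d" using w(1) by (metis index_vec index_zero_vec(1))
    moreover have "?M\<^sup>T *\<^sub>v vec d w = 0\<^sub>v d"
      using w(2) by (intro eq_vecI) (auto simp: scalar_prod_def atLeast0LessThan mult.commute)
    ultimately show ?L by (intro exI[of _ "vec d w"]) auto
  qed
  moreover have "(\<forall>k<d. (\<Sum>i<d. w i * bez_entry d a b (i + 1) k) = 0) \<longleftrightarrow>
      (\<Sum>i<d. smult (w i) (bez_row d a b (i + 1))) = 0" for w
  proof -
    have "(\<Sum>i<d. w i * bez_entry d a b (i + 1) k) =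
        fact d * fact k * coeff (\<Sum>i<d. smult (w i) (bez_row d a b (i + 1))) k" if "k < d" for k
      unfolding coeff_sum sum_distrib_left using that
      by (intro sum.cong) (auto simp: bez_entry_eq_coeff_bez_row)
    moreover have "coeff (\<Sum>i<d. smult (w i) (bez_row d a b (i + 1))) k = 0" if "d \<le> k" for k
      unfolding coeff_sum using that by (intro sum.neutral) (auto simp: coeff_bez_row_eq_0)
    ultimately show ?thesis
      by (auto simp: poly_eq_iff) (metis fact_nonzero linorder_not_le mult_eq_0_iff)
  qed
  ultimately show ?thesis by simp
qed

text \<open>A relation between the rows reads V_a * b = a * V_b. Without common roots a divides V_a,
  but V_a is nonzero and has degree below d, the degree of a.\<close>

lemma bez_det_nonzero:
  assumes ad: "a d \<noteq> 0"
    and no_root: "\<And>t. poly (exp_poly d a) t = 0 \<Longrightarrow> poly (exp_poly d b) t \<noteq> 0"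
  shows "bez_det d a b \<noteq> 0"
proof
  assume "bez_det d a b = 0"
  then obtain w where w: "\<exists>i<d. w i \<noteq> 0" "(\<Sum>i<d. smult (w i) (bez_row d a b (i + 1))) = 0"
    unfolding bez_det_0_iff_rows_dependent by blast
  define V where "V a = (\<Sum>i<d. smult (w i) (exp_poly_tail d a (i + 1)))" for a
  have "V b * exp_poly d a - V a * exp_poly d b = (\<Sum>i<d. smult (w i) (bez_row d a b (i + 1)))"
    by (simp add: V_def bez_row_def sum_distrib_right smult_diff_right sum_subtractf)
  then have "V a * exp_poly d b = exp_poly d a * V b"
    using w(2) by (simp add: mult.commute)
  then have "exp_poly d a dvd V a * exp_poly d b" by (rule dvdI)
  moreover have "exp_poly d a \<noteq> 0"
    using ad by (auto simp: poly_eq_iff coeff_exp_poly)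
  ultimately have dvd: "exp_poly d a dvd V a" using no_root by (rule dvd_of_no_common_root)
  \<comment> \<open>With \<open>i0\<close> the first nonzero weight, only row \<open>i0\<close>
    reaches degree \<open>d - (i0 + 1)\<close>: later quotients have smaller degree. This
    coefficient shows V_a to be nonzero.\<close>
  obtain i0 where i0: "i0 < d" "w i0 \<noteq> 0" "\<And>i. i < i0 \<Longrightarrow> w i = 0"
    using w(1) exists_least_iff[of "\<lambda>i. i < d \<and> w i \<noteq> 0"] by (metis order.strict_trans)
  have "coeff (V a) (d - (i0 + 1)) = (\<Sum>i<d. if i = i0 then w i0 * (a d / fact d) else 0)"
    unfolding coeff_sum V_def using i0
  proof (intro sum.cong refl)
    fix i assume "i \<in> {..<d}"
    consider "i < i0" | "i = i0" | "i > i0" by linarith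
    then show "coeff (smult (w i) (exp_poly_tail d a (i + 1))) (d - (i0 + 1)) =
        (if i = i0 then w i0 * (a d / fact d) else 0)"
      using i0 by cases (auto simp: coeff_exp_poly_tail)
  qed
  then have "coeff (V a) (d - (i0 + 1)) \<noteq> 0" using i0 ad by simp
  then have "V a \<noteq> 0" by (metis coeff_0)
  moreover have "degree (V a) < d"
  proof -
    have "degree (V a) \<le> d - 1" unfolding V_def
      by (intro degree_le) (auto simp: coeff_sum coeff_exp_poly_tail intro!: sum.neutral)
    then show ?thesis using i0(1) by simp
  qed
  ultimately show False using dvd_imp_degree_le[OF dvd] degree_exp_poly[of a d, OF ad] by simp
qed

lemma bez_det_swap: "bez_det d a b = (-1) ^ d * bez_det d b a"
proof -
  have "mat d d (\<lambda>(i, k). bez_entry d a b (i + 1) k) =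
      (-1) \<cdot>\<^sub>m mat d d (\<lambda>(i, k). bez_entry d b a (i + 1) k)"
    by (rule eq_matI) (auto simp: bez_entry_def simp flip: sum_negf intro!: sum.cong simp: algebra_simps)
  then show ?thesis by (simp add: bez_det_def)
qed

text \<open>The first alternative is a common zero at infinity of the two forms of degree d.\<close>

theorem bez_det_eq_0_iff:
  assumes "d > 0"
  shows "bez_det d a b = 0 \<longleftrightarrow> (a d = 0 \<and> b d = 0) \<or>
    (\<exists>t. poly (exp_poly d a) t = 0 \<and> poly (exp_poly d b) t = 0)"
proof (intro iffI; (elim disjE exE conjE)?)
  assume ab: "bez_det d a b = 0"
  then have ba: "bez_det d b a = 0" using bez_det_swap[of d b a] by simp
  show "(a d = 0 \<and> b d = 0) \<or> (\<exists>t. poly (exp_poly d a) t = 0 \<and> poly (exp_poly d b) t = 0)"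
  \<comment> \<open>\<open>bez_det_nonzero\<close> asks for a nonzero leading coefficient. If
    \<open>a d\<close> is zero, \<open>b d\<close> takes its place after a swap.\<close>
  proof (cases "a d = 0")
    case True
    then show ?thesis using bez_det_nonzero[of b d a] ba by auto
  next
    case False
    then show ?thesis using bez_det_nonzero[of a d b] ab by auto
  qed
next
  assume ab: "a d = 0" "b d = 0"
  \<comment> \<open>The quotient by t^d is a multiple of the leading coefficient, so the last row,
    of index \<open>d - 1\<close>, is zero.\<close>
  have "bez_row d a b d = 0"
  proof -
    have "exp_poly_tail d c d = 0" if "c d = 0" for c
      using that by (intro poly_eqI) (auto simp: coeff_exp_poly_tail)
    then show ?thesis using ab by (simp add: bez_row_def)
  qed
  then have "(\<Sum>i<d. smult (if i = d - 1 then 1 else 0) (bez_row d a b (i + 1))) = 0"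
    using assms by (intro sum.neutral) auto
  then show "bez_det d a b = 0"
    unfolding bez_det_0_iff_rows_dependent using assms
    by (intro exI[of _ "\<lambda>i. if i = d - 1 then 1 else 0"]) (auto intro!: exI[of _ "d - 1"])
next
  fix t assume t: "poly (exp_poly d a) t = 0" "poly (exp_poly d b) t = 0"
  let ?M = "mat d d (\<lambda>(i, k). bez_entry d a b (i + 1) k)"
  \<comment> \<open>A kernel vector: the denominators cancel the factors k! of the entries, so each
    row paired with it gives d! times the value of \<open>bez_row\<close> at the common
    root.\<close>
  let ?v = "vec d (\<lambda>k. t ^ k / fact k)"
  have "(\<Sum>k<d. bez_entry d a b (i + 1) k * (t ^ k / fact k)) = 0" if "i < d" for i
  proof -
    have "(\<Sum>k<d. bez_entry d a b (i + 1) k * (t ^ k / fact k)) =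
        fact d * (\<Sum>k<d. coeff (bez_row d a b (i + 1)) k * t ^ k)"
      unfolding sum_distrib_left using that
      by (intro sum.cong) (auto simp: bez_entry_eq_coeff_bez_row)
    also have "(\<Sum>k<d. coeff (bez_row d a b (i + 1)) k * t ^ k) = poly (bez_row d a b (i + 1)) t"
    proof -
      have "degree (bez_row d a b (i + 1)) \<le> d - 1"
        using that by (intro degree_le) (auto simp: coeff_bez_row_eq_0)
      then have "(\<Sum>k\<le>d - 1. monom (coeff (bez_row d a b (i + 1)) k) k) = bez_row d a b (i + 1)"
        by (rule poly_as_sum_of_monoms')
      then have "poly (\<Sum>k\<le>d - 1. monom (coeff (bez_row d a b (i + 1)) k) k) t =
          poly (bez_row d a b (i + 1)) t" by (rule arg_cong)
      moreover have "{..d - 1} = {..<d}" using assms by auto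
      ultimately show ?thesis by (simp only: poly_sum poly_monom)
    qed
    also have "\<dots> = 0" using t by (simp add: bez_row_def)
    finally show ?thesis by simp
  qed
  then have "?M *\<^sub>v ?v = 0\<^sub>v d"
    by (intro eq_vecI) (auto simp: scalar_prod_def atLeast0LessThan)
  moreover have "?v \<noteq> 0\<^sub>v d"
  proof
    assume "?v = 0\<^sub>v d"
    then have "?v $ 0 = 0\<^sub>v d $ 0" by simp
    then show False using assms by simp
  qed
  ultimately show "bez_det d a b = 0"
    unfolding bez_det_def by (subst det_0_iff_vec_prod_zero[where n = d]) (auto intro!: exI[of _ ?v])
qed

subsection \<open>Functions that are polynomial along lines\<close>

text \<open>A substitute for polynomial functions that suffices for density arguments and also
  covers functions such as q a b with one argument fixed.\<close>

definition poly_on_lines :: "(('v \<Rightarrow> complex) \<Rightarrow> complex) \<Rightarrow> bool" where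
  "poly_on_lines f \<longleftrightarrow> (\<forall>a b. \<exists>r. \<forall>s. f (\<lambda>i. a i + s * b i) = poly r s)"

lemma poly_on_lines_const: "poly_on_lines (\<lambda>_. c)"
  unfolding poly_on_lines_def by (auto intro!: exI[of _ "[:c:]"])

lemma poly_on_lines_diff:
  assumes "poly_on_lines f" "poly_on_lines g"
  shows "poly_on_lines (\<lambda>x. f x - g x)"
  unfolding poly_on_lines_def
proof (intro allI)
  fix a b
  obtain r r' where "\<forall>s. f (\<lambda>i. a i + s * b i) = poly r s" "\<forall>s. g (\<lambda>i. a i + s * b i) = poly r' s"
    using assms unfolding poly_on_lines_def by metis
  then show "\<exists>r. \<forall>s. f (\<lambda>i. a i + s * b i) - g (\<lambda>i. a i + s * b i) = poly r s"
    by (intro exI[of _ "r - r'"]) simp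
qed

lemma poly_on_lines_mult:
  assumes "poly_on_lines f" "poly_on_lines g"
  shows "poly_on_lines (\<lambda>x. f x * g x)"
  unfolding poly_on_lines_def
proof (intro allI)
  fix a b
  obtain r r' where "\<forall>s. f (\<lambda>i. a i + s * b i) = poly r s" "\<forall>s. g (\<lambda>i. a i + s * b i) = poly r' s"
    using assms unfolding poly_on_lines_def by metis
  then show "\<exists>r. \<forall>s. f (\<lambda>i. a i + s * b i) * g (\<lambda>i. a i + s * b i) = poly r s"
    by (intro exI[of _ "r * r'"]) simp
qed

lemma poly_on_lines_prod:
  "(\<And>i. i \<in> I \<Longrightarrow> poly_on_lines (f i)) \<Longrightarrow> poly_on_lines (\<lambda>x. \<Prod>i\<in>I. f i x)"
  by (induction I rule: infinite_finite_induct) (auto simp: poly_on_lines_const poly_on_lines_mult)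

text \<open>On the line from \<open>a\<close> to \<open>b\<close> both functions become nonzero
  univariate polynomials, and so does their product.\<close>

lemma poly_on_lines_both_nonzero:
  assumes f: "poly_on_lines f" and g: "poly_on_lines g" and "f a \<noteq> 0" "g b \<noteq> 0"
  shows "\<exists>s. f (\<lambda>i. a i + s * (b i - a i)) \<noteq> 0 \<and> g (\<lambda>i. a i + s * (b i - a i)) \<noteq> 0"
proof -
  obtain r r' where r: "\<And>s. f (\<lambda>i. a i + s * (b i - a i)) = poly r s"
    and r': "\<And>s. g (\<lambda>i. a i + s * (b i - a i)) = poly r' s"
    using f[unfolded poly_on_lines_def, rule_format, of a "\<lambda>i. b i - a i"]
      g[unfolded poly_on_lines_def, rule_format, of a "\<lambda>i. b i - a i"] by auto
  have "r \<noteq> 0" using r[of 0] assms(3) by auto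
  moreover have "r' \<noteq> 0" using r'[of 1] assms(4) by auto
  ultimately have "r * r' \<noteq> 0" by simp
  then obtain s where "poly (r * r') s \<noteq> 0" using poly_all_0_iff_0 by blast
  then show ?thesis by (intro exI[of _ s]) (simp add: r r')
qed

text \<open>Irreducibility of affine space, in the form used for generic choices.\<close>

lemma poly_on_lines_nonzero_ex:
  assumes "finite I" "\<And>i. i \<in> I \<Longrightarrow> poly_on_lines (f i)" "\<And>i. i \<in> I \<Longrightarrow> \<exists>x. f i x \<noteq> 0"
  shows "\<exists>x. \<forall>i\<in>I. f i x \<noteq> 0"
  using assms
proof (induction I rule: finite_induct)
  case (insert i I)
  then obtain b where b: "\<forall>j\<in>I. f j b \<noteq> 0" by auto
  obtain a where a: "f i a \<noteq> 0" using insert.prems by auto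
  have "(\<Prod>j\<in>I. f j b) \<noteq> 0" using b insert.hyps(1) by simp
  moreover have "poly_on_lines (\<lambda>x. \<Prod>j\<in>I. f j x)" "poly_on_lines (f i)"
    using insert.prems by (auto intro!: poly_on_lines_prod)
  ultimately obtain s where "f i (\<lambda>i. a i + s * (b i - a i)) \<noteq> 0"
    "(\<Prod>j\<in>I. f j (\<lambda>i. a i + s * (b i - a i))) \<noteq> 0"
    using poly_on_lines_both_nonzero[of "f i" "\<lambda>x. \<Prod>j\<in>I. f j x" a b] a by blast
  then show ?case using insert.hyps(1) by (intro exI[of _ "\<lambda>i. a i + s * (b i - a i)"]) auto
qed simp

text \<open>Density: an identity proved where \<open>g\<close> is nonzero extends to all
  points.\<close>

lemma poly_on_lines_eq_0:
  assumes "poly_on_lines f" "poly_on_lines g" "g b \<noteq> 0" "\<And>x. g x \<noteq> 0 \<Longrightarrow> f x = 0"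
  shows "f x = 0"
proof (rule ccontr)
  assume fx: "f x \<noteq> 0"
  obtain s where "f (\<lambda>i. x i + s * (b i - x i)) \<noteq> 0" "g (\<lambda>i. x i + s * (b i - x i)) \<noteq> 0"
    using poly_on_lines_both_nonzero[of f g x b] assms(1,2,3) fx by auto
  then show False using assms(4)[of "\<lambda>i. x i + s * (b i - x i)"] by simp
qed

lemma poly_on_lines_ceval: "poly_on_lines (\<lambda>x. ceval x p)"
  unfolding poly_on_lines_def
proof (intro allI)
  fix a b :: "'a \<Rightarrow> complex"
  obtain r where "\<And>t. ceval (\<lambda>i. poly [:a i, b i:] t) p = poly r t"
    using ceval_poly_curve_ex[of "\<lambda>i. [:a i, b i:]" p] by blast
  then show "\<exists>r. \<forall>s. ceval (\<lambda>i. a i + s * b i) p = poly r s" by auto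
qed

text \<open>A combination of \<open>p\<close> and \<open>q\<close> vanishing at a further point
  \<open>s'\<close> has more zeros than its degree allows.\<close>

lemma poly_proportional:
  fixes p q :: "complex poly"
  assumes "degree p \<le> card S" "degree q \<le> card S" "finite S"
    and p: "\<And>s. s \<in> S \<Longrightarrow> poly p s = 0" and q: "\<And>s. s \<in> S \<Longrightarrow> poly q s = 0"
  shows "poly q s * poly p s' = poly p s * poly q s'"
proof (cases "s' \<in> S")
  case False
  define r where "r = smult (poly p s') q - smult (poly q s') p"
  have "r = 0"
  proof (rule ccontr)
    assume "r \<noteq> 0"
    then have "finite {x. poly r x = 0}" "card {x. poly r x = 0} \<le> degree r"
      using poly_roots_finite card_poly_roots_bound by auto
    moreover have "insert s' S \<subseteq> {x. poly r x = 0}" using p q by (auto simp: r_def)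
    ultimately have "card (insert s' S) \<le> degree r" by (meson card_mono order_trans)
    moreover have "degree r \<le> card S"
      unfolding r_def using assms(1,2)
      by (meson degree_diff_le degree_smult_le order_trans)
    ultimately show False using False assms(3) by simp
  qed
  then have "poly r s = 0" by simp
  then show ?thesis by (simp add: r_def algebra_simps)
qed (simp add: p q)

subsection \<open>Linear forms\<close>

definition dotp :: "('v::finite \<Rightarrow> complex) \<Rightarrow> ('v \<Rightarrow> complex) \<Rightarrow> complex" where
  "dotp a v = (\<Sum>j\<in>UNIV. a j * v j)"

definition lin_form :: "('v::finite \<Rightarrow> complex) \<Rightarrow> 'v cpoly" where
  "lin_form v = (\<Sum>j\<in>UNIV. cvar j * cconst (v j))"

lemma ceval_lin_form [simp]: "ceval a (lin_form v) = dotp a v"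
  by (simp add: lin_form_def dotp_def ceval.hom_sum ceval_mult)

lemma dotp_scale_left: "dotp (\<lambda>i. c * a i) v = c * dotp a v"
  by (simp add: dotp_def sum_distrib_left mult.assoc)

lemma dotp_scale_right: "dotp a (\<lambda>i. c * v i) = c * dotp a v"
  by (simp add: dotp_def sum_distrib_left algebra_simps)

lemma dotp_add_left: "dotp (\<lambda>i. a i + b i) v = dotp a v + dotp b v"
  by (simp add: dotp_def sum.distrib algebra_simps)

lemma dotp_diff_left: "dotp (\<lambda>i. a i - b i) v = dotp a v - dotp b v"
  by (simp add: dotp_def sum_subtractf algebra_simps)

lemma dotp_unit: "dotp (\<lambda>i. if i = j then c else 0) v = c * v j"
  by (simp add: dotp_def if_distrib[of "\<lambda>x. x * _"] cong: if_cong)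

lemma dotp_zero_left: "dotp (\<lambda>_. 0) v = 0"
  by (simp add: dotp_def)

lemma poly_on_lines_dotp: "poly_on_lines (\<lambda>a. dotp a v)"
  using poly_on_lines_ceval[of "lin_form v"] by simp

text \<open>The form w made to vanish at u by correcting its i-th coefficient, multiplied by u_i to
  avoid division. The result is linear in u.\<close>

definition perp :: "'v::finite \<Rightarrow> ('v \<Rightarrow> complex) \<Rightarrow> ('v \<Rightarrow> complex) \<Rightarrow> 'v \<Rightarrow> complex" where
  "perp i w u = (\<lambda>j. u i * w j - (if j = i then dotp w u else 0))"

text \<open>In this shape w is paired with 2x2 minors of u and z, so generic choices of w can be
  made for fixed points u and z.\<close>

lemma dotp_perp: "dotp (perp i w u) z = dotp w (\<lambda>j. u i * z j - z i * u j)"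
proof -
  have "dotp (perp i w u) z = u i * dotp w z - dotp w u * z i"
    unfolding perp_def dotp_diff_left dotp_scale_left dotp_unit by simp
  also have "\<dots> = dotp w (\<lambda>j. u i * z j - z i * u j)"
    by (simp add: dotp_def sum_subtractf sum_distrib_left sum_distrib_right algebra_simps)
  finally show ?thesis .
qed

lemma dotp_perp_self: "dotp (perp i w u) u = 0"
  unfolding dotp_perp by (simp add: dotp_def)

subsection \<open>Homogeneity and projective points\<close>

abbreviation total_wt :: "('v::finite \<Rightarrow>\<^sub>0 nat) \<Rightarrow> nat" where
  "total_wt m \<equiv> \<Sum>i\<in>UNIV. Poly_Mapping.lookup m i"

abbreviation left_wt :: "('v::finite + 'w::finite \<Rightarrow>\<^sub>0 nat) \<Rightarrow> nat" where
  "left_wt m \<equiv> \<Sum>i\<in>UNIV. Poly_Mapping.lookup m (Inl i)"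

abbreviation right_wt :: "('v::finite + 'w::finite \<Rightarrow>\<^sub>0 nat) \<Rightarrow> nat" where
  "right_wt m \<equiv> \<Sum>i\<in>UNIV. Poly_Mapping.lookup m (Inr i)"

interpretation total: additive_weight total_wt
  by standard (simp add: lookup_add sum.distrib)

interpretation left: additive_weight left_wt
  by standard (simp add: lookup_add sum.distrib)

interpretation right: additive_weight right_wt
  by standard (simp add: lookup_add sum.distrib)

lemma homogeneous_iff: "homogeneous k p \<longleftrightarrow> homog_wt total_wt k p"
  by (simp add: homogeneous_def homog_wt_def)

lemma bihomogeneous_iff: "bihomogeneous k l p \<longleftrightarrow> homog_wt left_wt k p \<and> homog_wt right_wt l p"
  by (auto simp: bihomogeneous_def homog_wt_def)

lemma homog_wt_cvar: "w (Poly_Mapping.single i 1) = k \<Longrightarrow> homog_wt w k (cvar i)"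
  by (simp add: homog_wt_def cvar_def)

lemma (in additive_weight) homog_wt_lin:
  assumes "\<And>j. w (Poly_Mapping.single (f j) 1) = k"
  shows "homog_wt w k (\<Sum>j\<in>A. cvar (f j) * cconst (c j))"
proof (rule homog_wt_sum)
  fix j
  show "homog_wt w k (cvar (f j) * cconst (c j))"
    using homog_wt_mult[OF homog_wt_cvar[of w "f j", OF assms] homog_wt_cconst[of "c j"]] by simp
qed

lemma homogeneous_cvar: "homogeneous 1 (cvar i)"
  unfolding homogeneous_iff by (rule homog_wt_cvar) (simp add: lookup_single when_def)

lemma homogeneous_cconst: "homogeneous 0 (cconst c)"
  unfolding homogeneous_iff by (rule total.homog_wt_cconst)

lemma homogeneous_mult: "homogeneous k p \<Longrightarrow> homogeneous l q \<Longrightarrow> homogeneous (k + l) (p * q)"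
  unfolding homogeneous_iff by (rule total.homog_wt_mult)

lemma homogeneous_diff: "homogeneous k p \<Longrightarrow> homogeneous k q \<Longrightarrow> homogeneous k (p - q)"
  unfolding homogeneous_iff by (rule total.homog_wt_diff)

lemma homogeneous_sum: "(\<And>i. i \<in> A \<Longrightarrow> homogeneous k (f i)) \<Longrightarrow> homogeneous k (sum f A)"
  unfolding homogeneous_iff by (rule total.homog_wt_sum)

lemma homogeneous_mult_cconst: "homogeneous k p \<Longrightarrow> homogeneous k (p * cconst c)"
  using homogeneous_mult[OF _ homogeneous_cconst, of k p] by simp

lemma homogeneous_lin_form: "homogeneous 1 (lin_form v)"
  unfolding lin_form_def by (intro homogeneous_sum homogeneous_mult_cconst homogeneous_cvar)

lemma homogeneous_bez_det:
  assumes "\<And>l. homogeneous i (a l)" "\<And>l. homogeneous j (b l)"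
  shows "homogeneous (d * (i + j)) (bez_det d a b)"
  using assms unfolding homogeneous_iff by (rule total.homog_wt_bez_det)

lemma ceval_scale:
  assumes "homogeneous k p"
  shows "ceval (\<lambda>i. c * v i) p = c ^ k * ceval v p"
  unfolding ceval_def sum_distrib_left using assms
  by (intro sum.cong) (auto simp: power_mult_distrib prod.distrib homogeneous_def simp flip: power_sum)

lemma prod_UNIV_sum:
  "(\<Prod>i\<in>(UNIV :: ('a::finite + 'b::finite) set). f i) =
    (\<Prod>i\<in>UNIV. f (Inl i)) * (\<Prod>i\<in>UNIV. f (Inr i))"
  using prod.Plus[of "UNIV :: 'a set" "UNIV :: 'b set" f] by (simp add: UNIV_Plus_UNIV comp_def)

lemma sum_UNIV_sum:
  "(\<Sum>i\<in>(UNIV :: ('a::finite + 'b::finite) set). f i) =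
    (\<Sum>i\<in>UNIV. f (Inl i)) + (\<Sum>i\<in>UNIV. f (Inr i))"
  using sum.Plus[of "UNIV :: 'a set" "UNIV :: 'b set" f] by (simp add: UNIV_Plus_UNIV comp_def)

lemma ceval_biscale:
  assumes "bihomogeneous k l p"
  shows "ceval (case_sum (\<lambda>i. c * a i) (\<lambda>i. c' * b i)) p = c ^ k * c' ^ l * ceval (case_sum a b) p"
  unfolding ceval_def sum_distrib_left using assms
  by (intro sum.cong) (auto simp: prod_UNIV_sum power_mult_distrib prod.distrib bihomogeneous_def
      simp flip: power_sum)

lemma proj_pt_self: "v \<in> proj_pt v"
  unfolding proj_pt_def by (auto intro!: exI[of _ 1])

lemma proj_pt_scale: "c \<noteq> 0 \<Longrightarrow> proj_pt (\<lambda>i. c * v i) = proj_pt v"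
proof (intro Set.set_eqI iffI)
  fix x assume c: "c \<noteq> 0" and "x \<in> proj_pt v"
  then obtain k where "k \<noteq> 0" "x = (\<lambda>i. k * v i)" by (auto simp: proj_pt_def)
  then show "x \<in> proj_pt (\<lambda>i. c * v i)"
    unfolding proj_pt_def using c by (auto intro!: exI[of _ "k / c"])
next
  fix x assume c: "c \<noteq> 0" and "x \<in> proj_pt (\<lambda>i. c * v i)"
  then obtain k where "k \<noteq> 0" "x = (\<lambda>i. k * (c * v i))" by (auto simp: proj_pt_def)
  then show "x \<in> proj_pt v"
    unfolding proj_pt_def using c by (auto intro!: exI[of _ "k * c"])
qed

lemma proj_pt_eqD:
  assumes "proj_pt u = proj_pt v"
  obtains c where "c \<noteq> 0" "u = (\<lambda>i. c * v i)"
proof -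
  have "u \<in> proj_pt v" using proj_pt_self[of u] by (simp add: assms)
  then show ?thesis using that by (auto simp: proj_pt_def)
qed

lemma proj_pt_in_space: "proj_pt v \<in> proj_space \<longleftrightarrow> v \<noteq> (\<lambda>_. 0)"
proof
  assume "proj_pt v \<in> proj_space"
  then obtain u where "u \<noteq> (\<lambda>_. 0)" "proj_pt u = proj_pt v" by (auto simp: proj_space_def)
  then show "v \<noteq> (\<lambda>_. 0)" by (metis mult_zero_right proj_pt_eqD)
qed (auto simp: proj_space_def)

lemma proj_spaceE:
  assumes "y \<in> proj_space"
  obtains v where "y = proj_pt v" "v \<noteq> (\<lambda>_. 0)"
  using assms by (auto simp: proj_space_def)

text \<open>By homogeneity one representative decides for all.\<close>

lemma proj_pt_in_zeros:
  assumes "\<forall>p\<in>S. \<exists>k. homogeneous k p"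
  shows "proj_pt v \<in> proj_zeros S \<longleftrightarrow> v \<noteq> (\<lambda>_. 0) \<and> (\<forall>p\<in>S. ceval v p = 0)"
proof -
  have "ceval u p = 0" if "p \<in> S" "u \<in> proj_pt v" "ceval v p = 0" for p u
    using that assms ceval_scale by (fastforce simp: proj_pt_def)
  then show ?thesis
    using proj_pt_self[of v] by (auto simp: proj_zeros_def proj_pt_in_space)
qed

lemma proj_pt_in_hyperplane:
  "proj_pt v \<in> hyperplane (proj_pt a) \<longleftrightarrow> v \<noteq> (\<lambda>_. 0) \<and> dotp a v = 0"
proof -
  have "dotp a' v' = 0" if "a' \<in> proj_pt a" "v' \<in> proj_pt v" "dotp a v = 0" for a' v'
    using that by (auto simp: proj_pt_def dotp_scale_left dotp_scale_right)
  then show ?thesis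
    using proj_pt_self[of v] proj_pt_self[of a]
    by (auto simp: hyperplane_def proj_pt_in_space simp flip: dotp_def)
qed

lemma proj_pt_in_biproj_zeros:
  assumes "bihomogeneous k l Q"
  shows "(proj_pt a, proj_pt b) \<in> biproj_zeros Q \<longleftrightarrow>
    a \<noteq> (\<lambda>_. 0) \<and> b \<noteq> (\<lambda>_. 0) \<and> ceval (case_sum a b) Q = 0"
proof -
  have "ceval (case_sum a' b') Q = 0"
    if "a' \<in> proj_pt a" "b' \<in> proj_pt b" "ceval (case_sum a b) Q = 0" for a' b'
    using that ceval_biscale[OF assms] by (auto simp: proj_pt_def)
  then show ?thesis
    using proj_pt_self[of a] proj_pt_self[of b] by (auto simp: biproj_zeros_def proj_pt_in_space)
qed

text \<open>If these minors all vanish, \<open>z\<close> is \<open>z i / u i\<close> times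
  \<open>u\<close>, and the factor is nonzero because \<open>z\<close> is.\<close>

lemma proj_pt_neqD:
  assumes "proj_pt z \<noteq> proj_pt u" "z \<noteq> (\<lambda>_. 0)" "u i \<noteq> 0"
  shows "\<exists>j. u i * z j - z i * u j \<noteq> 0"
proof (rule ccontr)
  assume "\<not> ?thesis"
  then have z: "z = (\<lambda>j. z i / u i * u j)" using assms(3) by (auto simp: field_simps fun_eq_iff)
  then have "z i / u i \<noteq> 0" using assms(2) by (metis mult_zero_left)
  then show False using z assms(1) proj_pt_scale by metis
qed

subsection \<open>The Zariski topology on projective space\<close>

lemma zariski_closed_subset: "zariski_closed Z \<Longrightarrow> Z \<subseteq> proj_space"
  by (auto simp: zariski_closed_def proj_zeros_def)

text \<open>The union is cut out by the pairwise products of the equations.\<close>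

lemma zariski_closed_Un:
  assumes "zariski_closed A" "zariski_closed B"
  shows "zariski_closed (A \<union> B)"
proof -
  obtain S T where S: "\<forall>p\<in>S. \<exists>k. homogeneous k p" "A = proj_zeros S"
    and T: "\<forall>p\<in>T. \<exists>k. homogeneous k p" "B = proj_zeros T"
    using assms unfolding zariski_closed_def by auto
  let ?U = "{p * q | p q. p \<in> S \<and> q \<in> T}"
  have U: "\<forall>p\<in>?U. \<exists>k. homogeneous k p" using S(1) T(1) homogeneous_mult by blast
  have "A \<union> B = proj_zeros ?U"
  proof (intro Set.set_eqI)
    fix y
    show "y \<in> A \<union> B \<longleftrightarrow> y \<in> proj_zeros ?U"
    proof (cases "y \<in> proj_space")
      case True
      then obtain v where v: "y = proj_pt v" "v \<noteq> (\<lambda>_. 0)" by (rule proj_spaceE)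
      have "(\<forall>p\<in>?U. ceval v p = 0) \<longleftrightarrow> (\<forall>p\<in>S. \<forall>q\<in>T. ceval v (p * q) = 0)" by blast
      also have "\<dots> \<longleftrightarrow> (\<forall>p\<in>S. \<forall>q\<in>T. ceval v p = 0 \<or> ceval v q = 0)" by (simp add: ceval_mult)
      also have "\<dots> \<longleftrightarrow> (\<forall>p\<in>S. ceval v p = 0) \<or> (\<forall>q\<in>T. ceval v q = 0)" by blast
      finally show ?thesis
        unfolding S(2) T(2) v(1) Un_iff proj_pt_in_zeros[OF S(1)] proj_pt_in_zeros[OF T(1)]
          proj_pt_in_zeros[OF U] using v(2) by simp
    next
      case False
      then show ?thesis unfolding S(2) T(2) by (simp add: proj_zeros_def)
    qed
  qed
  then show ?thesis unfolding zariski_closed_def using U by blast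
qed

lemma zariski_closed_empty: "zariski_closed {}"
proof -
  have "ceval v (cconst 1) \<noteq> 0" for v :: "'a \<Rightarrow> complex" by simp
  then have "{} = proj_zeros {cconst 1 :: 'a cpoly}"
    using proj_pt_self by (fastforce simp: proj_zeros_def elim!: proj_spaceE)
  then show ?thesis unfolding zariski_closed_def
    by (intro exI[of _ "{cconst 1}"]) (auto intro: homogeneous_cconst)
qed

lemma zariski_closed_singleton:
  assumes "y \<in> proj_space"
  shows "zariski_closed {y}"
proof -
  obtain v where v: "y = proj_pt v" "v \<noteq> (\<lambda>_. 0)" using assms by (rule proj_spaceE)
  then obtain i where i: "v i \<noteq> 0" by auto
  \<comment> \<open>Minors with a coordinate \<open>i\<close> at which \<open>v\<close> is nonzero;
    they express proportionality to \<open>v\<close>.\<close>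
  let ?S = "range (\<lambda>j. cvar j * cconst (v i) - cvar i * cconst (v j))"
  have S: "\<forall>p\<in>?S. \<exists>k. homogeneous k p"
    by (auto intro!: exI[of _ 1] homogeneous_diff homogeneous_mult_cconst homogeneous_cvar)
  have "{y} = proj_zeros ?S"
  proof (intro Set.set_eqI)
    fix x
    show "x \<in> {y} \<longleftrightarrow> x \<in> proj_zeros ?S"
    proof (cases "x \<in> proj_space")
      case True
      then obtain u where u: "x = proj_pt u" "u \<noteq> (\<lambda>_. 0)" by (rule proj_spaceE)
      have "proj_pt u = proj_pt v \<longleftrightarrow> (\<forall>j. u j * v i - u i * v j = 0)"
      proof
        assume "proj_pt u = proj_pt v"
        then show "\<forall>j. u j * v i - u i * v j = 0" by (elim proj_pt_eqD) simp
      next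
        assume "\<forall>j. u j * v i - u i * v j = 0"
        then show "proj_pt u = proj_pt v"
          using proj_pt_neqD[of u v i] i u(2) by (auto simp: mult.commute)
      qed
      then show ?thesis unfolding u(1) v(1) proj_pt_in_zeros[OF S] using u(2)
        by (auto simp: ceval.hom_minus ceval_mult)
    next
      case False
      then show ?thesis using assms by (auto simp: proj_zeros_def)
    qed
  qed
  then show ?thesis unfolding zariski_closed_def using S by blast
qed

lemma zariski_closed_finite:
  assumes "finite Z" "Z \<subseteq> proj_space"
  shows "zariski_closed Z"
  using assms
proof (induction Z rule: finite_induct)
  case (insert y Z)
  then show ?case
    using zariski_closed_Un[OF zariski_closed_singleton[of y], of Z] by simp
qed (rule zariski_closed_empty)

lemma irreducible_closed_singleton: "y \<in> proj_space \<Longrightarrow> irreducible_closed {y}"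
  unfolding irreducible_closed_def by (simp add: zariski_closed_singleton)

text \<open>A point of \<open>Z\<close> and the rest of \<open>Z\<close> are both closed.\<close>

lemma irreducible_closed_finite:
  assumes "irreducible_closed Z" "finite Z"
  obtains y where "Z = {y}"
proof -
  obtain y where y: "y \<in> Z" using assms(1) unfolding irreducible_closed_def by blast
  have sub: "Z \<subseteq> proj_space" using assms(1) by (simp add: irreducible_closed_def zariski_closed_subset)
  have "zariski_closed {y}" "zariski_closed (Z - {y})"
    using y sub assms(2) by (auto intro!: zariski_closed_finite)
  moreover have "Z \<subseteq> {y} \<union> (Z - {y})" by blast
  ultimately have "Z \<subseteq> {y} \<or> Z \<subseteq> Z - {y}"
    using assms(1) unfolding irreducible_closed_def by blast
  then show ?thesis using y that by blast
qed

text \<open>\<open>chow_point\<close> leaves the degree existential, so the bidegree of an equation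
  is known only through this uniqueness. A hyperplane generic for both exceptional hypersurfaces is
  counted twice.\<close>

lemma has_degree_unique:
  fixes C :: "('v::finite) ppoint set"
  assumes "has_degree C d" "has_degree C d'"
  shows "d = d'"
proof -
  obtain G k where G: "homogeneous k G" "G \<noteq> 0"
    "\<And>\<alpha>. \<alpha> \<in> proj_space - proj_zeros {G} \<Longrightarrow> card (C \<inter> hyperplane \<alpha>) = d"
    using assms(1) unfolding has_degree_def by blast
  obtain G' k' where G': "homogeneous k' G'" "G' \<noteq> 0"
    "\<And>\<alpha>. \<alpha> \<in> proj_space - proj_zeros {G'} \<Longrightarrow> card (C \<inter> hyperplane \<alpha>) = d'"
    using assms(2) unfolding has_degree_def by blast
  \<comment> \<open>An arbitrary coordinate; asking it to be nonzero makes the vector found below a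
    projective point.\<close>
  define i :: 'v where "i = undefined"
  have "\<exists>x. \<forall>p\<in>{G, G', cvar i}. ceval x p \<noteq> 0"
  proof (rule poly_on_lines_nonzero_ex)
    fix p assume "p \<in> {G, G', cvar i}"
    moreover have "ceval (\<lambda>_. 1) (cvar i) \<noteq> 0" by simp
    ultimately show "\<exists>x. ceval x p \<noteq> 0" using G(2) G'(2) ceval_nonzero_ex by blast
  qed (auto simp: poly_on_lines_ceval)
  then obtain x where x: "ceval x G \<noteq> 0" "ceval x G' \<noteq> 0" "x i \<noteq> 0" by auto
  have "x \<noteq> (\<lambda>_. 0)" using x(3) by auto
  then have "proj_pt x \<in> proj_space - proj_zeros {G}" "proj_pt x \<in> proj_space - proj_zeros {G'}"
    using x(1,2) proj_pt_self[of x] by (auto simp: proj_pt_in_space proj_zeros_def)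
  then show ?thesis using G(3) G'(3) by metis
qed

subsection \<open>Projective closures of polynomial curves\<close>

text \<open>The situation without derivations: \<open>v l\<close> is the l-th derivative of the
  curve at 0 and \<open>o\<^sub>0\<close> the homogenizing coordinate, constantly 1 along the curve.
  Injectivity turns the count of roots into a count of points.\<close>

locale poly_curve =
  fixes d :: nat and v :: "nat \<Rightarrow> 'v::finite \<Rightarrow> complex" and o\<^sub>0 :: 'v
  assumes d_pos: "d > 0"
    and v_0: "v 0 o\<^sub>0 = 1"
    and v_pos: "l > 0 \<Longrightarrow> v l o\<^sub>0 = 0"
    and v_gt: "l > d \<Longrightarrow> v l = (\<lambda>_. 0)"
    and v_d: "v d \<noteq> (\<lambda>_. 0)"
    and inj_curve: "inj (\<lambda>t j. poly (exp_poly d (\<lambda>l. v l j)) t)"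
begin

definition \<gamma> :: "complex \<Rightarrow> 'v \<Rightarrow> complex" where
  "\<gamma> t = (\<lambda>j. poly (exp_poly d (\<lambda>l. v l j)) t)"

definition curve :: "'v ppoint set" where
  "curve = insert (proj_pt (v d)) (range (\<lambda>t. proj_pt (\<gamma> t)))"

abbreviation pol :: "('v \<Rightarrow> complex) \<Rightarrow> complex poly" where
  "pol a \<equiv> exp_poly d (\<lambda>l. dotp a (v l))"

abbreviation bez :: "('v \<Rightarrow> complex) \<Rightarrow> ('v \<Rightarrow> complex) \<Rightarrow> complex" where
  "bez a b \<equiv> bez_det d (\<lambda>l. dotp a (v l)) (\<lambda>l. dotp b (v l))"

lemma poly_pol: "poly (pol a) t = dotp a (\<gamma> t)"
proof -
  have "poly (pol a) t = (\<Sum>l\<le>d. \<Sum>j\<in>UNIV. a j * (v l j / fact l * t ^ l))"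
    by (simp add: poly_exp_poly dotp_def sum_divide_distrib sum_distrib_right mult.assoc)
  also have "\<dots> = (\<Sum>j\<in>UNIV. a j * (\<Sum>l\<le>d. v l j / fact l * t ^ l))"
    by (subst sum.swap) (simp add: sum_distrib_left)
  finally show ?thesis by (simp add: dotp_def \<gamma>_def poly_exp_poly)
qed

lemma \<gamma>_o: "\<gamma> t o\<^sub>0 = 1"
proof -
  have "\<gamma> t o\<^sub>0 = (\<Sum>j\<le>d. if j = 0 then 1 else 0)"
    unfolding \<gamma>_def poly_exp_poly using v_0 v_pos by (intro sum.cong) auto
  then show ?thesis by simp
qed

lemma \<gamma>_nonzero: "\<gamma> t \<noteq> (\<lambda>_. 0)"
  using \<gamma>_o[of t] by auto

lemma inj_\<gamma>: "inj \<gamma>"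
  using inj_curve unfolding \<gamma>_def .

text \<open>Since the coordinate \<open>o\<^sub>0\<close> is 1, proportional points of the curve are
  equal.\<close>

lemma inj_proj_\<gamma>: "inj (\<lambda>t. proj_pt (\<gamma> t))"
proof (rule injI)
  fix s t assume "proj_pt (\<gamma> s) = proj_pt (\<gamma> t)"
  then obtain c where c: "\<gamma> s = (\<lambda>i. c * \<gamma> t i)" by (rule proj_pt_eqD)
  then have "c = 1" using \<gamma>_o[of s] \<gamma>_o[of t] by (metis mult.right_neutral)
  then have "\<gamma> s = \<gamma> t" using c by simp
  then show "s = t" using inj_\<gamma> by (simp add: inj_def)
qed

lemma v_d_o: "v d o\<^sub>0 = 0"
  using v_pos d_pos by simp

lemma curve_subset: "curve \<subseteq> proj_space"
  by (auto simp: curve_def proj_pt_in_space v_d \<gamma>_nonzero)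

lemma bez_eq_0_iff:
  "bez a b = 0 \<longleftrightarrow> (dotp a (v d) = 0 \<and> dotp b (v d) = 0) \<or>
    (\<exists>t. dotp a (\<gamma> t) = 0 \<and> dotp b (\<gamma> t) = 0)"
  using bez_det_eq_0_iff[OF d_pos] by (simp add: poly_pol)

lemma finite_roots:
  assumes "dotp a (v d) \<noteq> 0"
  shows "finite {t. dotp a (\<gamma> t) = 0}"
proof -
  have "coeff (pol a) d \<noteq> 0" using assms by (simp add: coeff_exp_poly)
  then have "pol a \<noteq> 0" by auto
  then show ?thesis using poly_roots_finite[of "pol a"] by (simp add: poly_pol)
qed

text \<open>The point at infinity is handled by the substitution \<open>t = 1 / s\<close>.\<close>

lemma homogeneous_vanishes_on_curve:
  assumes hom: "homogeneous k p" and inf: "infinite {t. ceval (\<gamma> t) p = 0}"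
  shows "ceval (\<gamma> t) p = 0" "ceval (v d) p = 0"
proof -
  obtain r where r: "\<And>t. ceval (\<gamma> t) p = poly r t"
    unfolding \<gamma>_def using ceval_poly_curve_ex[of "\<lambda>j. exp_poly d (\<lambda>l. v l j)" p] by blast
  have "r = 0" using inf poly_roots_finite[of r] by (auto simp: r)
  then have 0: "ceval (\<gamma> t) p = 0" for t by (simp add: r)
  show "ceval (\<gamma> t) p = 0" by (rule 0)
  \<comment> \<open>The reversed coordinates s^d \<gamma>(1/s), which are polynomials in s with
    value v_d / d! at s = 0.\<close>
  define c where "c j = (\<Sum>l\<le>d. monom (v l j / fact l) (d - l))" for j
  obtain r' where r': "\<And>s. ceval (\<lambda>j. poly (c j) s) p = poly r' s"
    using ceval_poly_curve_ex[of c p] by blast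
  have "poly r' s = 0" if s: "s \<noteq> 0" for s
  proof -
    have "poly (c j) s = s ^ d * \<gamma> (1 / s) j" for j
    proof -
      have "s ^ (d - l) = s ^ d * (1 / s) ^ l" if "l \<le> d" for l
        using s that by (simp add: power_diff power_one_over field_simps)
      then show ?thesis
        unfolding c_def \<gamma>_def poly_exp_poly poly_sum poly_monom sum_distrib_left
        by (intro sum.cong) (auto simp: algebra_simps)
    qed
    then have "poly r' s = ceval (\<lambda>j. s ^ d * \<gamma> (1 / s) j) p" by (simp flip: r')
    then show ?thesis using ceval_scale[OF hom] 0 by simp
  qed
  then have "UNIV - {0} \<subseteq> {s. poly r' s = 0}" by auto
  moreover have "infinite (UNIV - {0 :: complex})" by (simp add: infinite_UNIV_char_0)
  ultimately have "r' = 0" using poly_roots_finite[of r'] finite_subset by blast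
  then have "ceval (\<lambda>j. poly (c j) 0) p = 0" by (simp add: r')
  moreover have "poly (c j) 0 = 1 / fact d * v d j" for j
  proof -
    have "poly (c j) 0 = (\<Sum>l\<le>d. if l = d then v d j / fact d else 0)"
      unfolding c_def poly_sum poly_monom by (intro sum.cong) auto
    then show ?thesis by simp
  qed
  ultimately have "ceval (\<lambda>j. 1 / fact d * v d j) p = 0" by simp
  then have "(1 / fact d) ^ k * ceval (v d) p = 0" by (simp only: ceval_scale[OF hom])
  then show "ceval (v d) p = 0" by simp
qed

text \<open>Each equation of \<open>Z\<close> has infinitely many zeros along the curve. Closure,
  irreducibility and dimension are all derived from this.\<close>

lemma curve_subset_closed:
  assumes "zariski_closed Z" "infinite {t. proj_pt (\<gamma> t) \<in> Z}"
  shows "curve \<subseteq> Z"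
proof -
  obtain S where S: "\<forall>p\<in>S. \<exists>k. homogeneous k p" "Z = proj_zeros S"
    using assms(1) unfolding zariski_closed_def by blast
  have "ceval (\<gamma> t) p = 0 \<and> ceval (v d) p = 0" if p: "p \<in> S" for p t
  proof -
    obtain k where k: "homogeneous k p" using S(1) p by blast
    have "{t. proj_pt (\<gamma> t) \<in> Z} \<subseteq> {t. ceval (\<gamma> t) p = 0}"
      unfolding S(2) proj_pt_in_zeros[OF S(1)] using p by blast
    then have "infinite {t. ceval (\<gamma> t) p = 0}" using assms(2) finite_subset by blast
    then show ?thesis using homogeneous_vanishes_on_curve[OF k] by blast
  qed
  then show ?thesis
    by (auto simp: curve_def S(2) proj_pt_in_zeros[OF S(1)] v_d \<gamma>_nonzero)
qed

text \<open>A point \<open>u\<close> off the curve is the common zero of two linear forms without common zero on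
  the curve, and all forms vanishing at \<open>u\<close> are of the shape \<open>perp i w u\<close>. So the curve is cut
  out by the Bezout determinants of pairs of such forms, which are polynomials in \<open>u\<close>.\<close>

lemma zariski_closed_curve: "zariski_closed curve"
proof -
  \<comment> \<open>The value of \<open>perp i w u\<close> on \<open>v l\<close>, as a polynomial in
    the coordinates of \<open>u\<close>.\<close>
  define A where "A i w l = cvar i * cconst (dotp w (v l)) - lin_form w * cconst (v l i)"
    for i :: 'v and w l
  define S where "S = {bez_det d (A i w) (A i w') | i w w'. True}"
  have ceval_A: "ceval u (A i w l) = dotp (perp i w u) (v l)" for u i w l
    unfolding A_def perp_def dotp_diff_left dotp_scale_left dotp_unit
    by (simp add: ceval.hom_minus ceval_mult dotp_def mult.commute)
  have "homogeneous 1 (A i w l)" for i w l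
    unfolding A_def
    by (intro homogeneous_diff homogeneous_mult_cconst homogeneous_cvar homogeneous_lin_form)
  then have S: "\<forall>p\<in>S. \<exists>k. homogeneous k p"
    unfolding S_def using homogeneous_bez_det by blast
  have ceval_S: "ceval u (bez_det d (A i w) (A i w')) = bez (perp i w u) (perp i w' u)" for u i w w'
    by (simp add: ceval.hom_bez_det ceval_A)
  have "curve = proj_zeros S"
  proof (intro Set.set_eqI)
    fix y
    show "y \<in> curve \<longleftrightarrow> y \<in> proj_zeros S"
    proof (cases "y \<in> proj_space")
      case True
      then obtain u where u: "y = proj_pt u" "u \<noteq> (\<lambda>_. 0)" by (rule proj_spaceE)
      have "y \<in> proj_zeros S \<longleftrightarrow> (\<forall>i w w'. bez (perp i w u) (perp i w' u) = 0)"
      proof -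
        have "(\<forall>p\<in>S. ceval u p = 0) \<longleftrightarrow> (\<forall>i w w'. ceval u (bez_det d (A i w) (A i w')) = 0)"
          unfolding S_def by blast
        then show ?thesis unfolding u(1) proj_pt_in_zeros[OF S] using u(2) by (simp add: ceval_S)
      qed
      also have "\<dots> \<longleftrightarrow> y \<in> curve"
      proof
        assume "y \<in> curve"
        then consider "proj_pt (v d) = proj_pt u" | t where "proj_pt (\<gamma> t) = proj_pt u"
          unfolding curve_def u(1) by auto
        then show "\<forall>i w w'. bez (perp i w u) (perp i w' u) = 0"
        proof cases
          case 1
          then obtain c where c: "v d = (\<lambda>i. c * u i)" by (rule proj_pt_eqD)
          have "dotp (perp i w u) (v d) = 0" for i w
            unfolding c by (simp add: dotp_scale_right dotp_perp_self)
          then show ?thesis unfolding bez_eq_0_iff by blast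
        next
          case (2 t)
          then obtain c where c: "\<gamma> t = (\<lambda>i. c * u i)" by (rule proj_pt_eqD)
          have "dotp (perp i w u) (\<gamma> t) = 0" for i w
            unfolding c by (simp add: dotp_scale_right dotp_perp_self)
          then show ?thesis unfolding bez_eq_0_iff by blast
        qed
      next
        assume all: "\<forall>i w w'. bez (perp i w u) (perp i w' u) = 0"
        show "y \<in> curve"
        proof (rule ccontr)
          assume "y \<notin> curve"
          then have neq: "proj_pt (v d) \<noteq> proj_pt u" "\<And>t. proj_pt (\<gamma> t) \<noteq> proj_pt u"
            unfolding curve_def u(1) by auto
          obtain i where i: "u i \<noteq> 0" using u(2) by auto
          obtain j where j: "u i * v d j - v d i * u j \<noteq> 0"
            using proj_pt_neqD[of "v d" u i] neq(1) v_d i by blast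
          \<comment> \<open>This \<open>w\<close> selects a nonzero minor, so its form misses the
            point at infinity and has finitely many zeros on the curve.\<close>
          define w where "w = (\<lambda>k. if k = j then 1 else 0 :: complex)"
          have w: "dotp (perp i w u) (v d) \<noteq> 0"
            unfolding dotp_perp w_def dotp_unit using j by simp
          \<comment> \<open>A generic second form through \<open>u\<close> avoids these finitely
            many points.\<close>
          have "\<exists>w'. \<forall>t\<in>{t. dotp (perp i w u) (\<gamma> t) = 0}.
              dotp w' (\<lambda>j. u i * \<gamma> t j - \<gamma> t i * u j) \<noteq> 0"
          proof (rule poly_on_lines_nonzero_ex)
            show "finite {t. dotp (perp i w u) (\<gamma> t) = 0}" by (rule finite_roots[OF w])
            show "\<exists>x. dotp x (\<lambda>j. u i * \<gamma> t j - \<gamma> t i * u j) \<noteq> 0" for t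
            proof -
              obtain j where "u i * \<gamma> t j - \<gamma> t i * u j \<noteq> 0"
                using proj_pt_neqD[of "\<gamma> t" u i] neq(2) \<gamma>_nonzero i by blast
              then show ?thesis
                by (intro exI[of _ "\<lambda>k. if k = j then 1 else 0"]) (simp add: dotp_unit)
            qed
          qed (rule poly_on_lines_dotp)
          then obtain w' where "\<And>t. dotp (perp i w u) (\<gamma> t) = 0 \<Longrightarrow> dotp (perp i w' u) (\<gamma> t) \<noteq> 0"
            unfolding dotp_perp[of i _ u "\<gamma> _"] by blast
          then show False using all w unfolding bez_eq_0_iff by blast
        qed
      qed
      finally show ?thesis by blast
    next
      case False
      then show ?thesis using curve_subset by (auto simp: proj_zeros_def)
    qed
  qed
  then show ?thesis unfolding zariski_closed_def using S by blast
qed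

lemma closure_curve: "zariski_closed hull (range (\<lambda>t. proj_pt (\<gamma> t))) = curve"
proof (rule hull_unique)
  show "range (\<lambda>t. proj_pt (\<gamma> t)) \<subseteq> curve" by (auto simp: curve_def)
  fix Z assume "range (\<lambda>t. proj_pt (\<gamma> t)) \<subseteq> Z" and Z: "zariski_closed Z"
  then have "{t. proj_pt (\<gamma> t) \<in> Z} = UNIV" by auto
  then show "curve \<subseteq> Z" using curve_subset_closed[OF Z] by (simp add: infinite_UNIV_char_0)
qed (rule zariski_closed_curve)

text \<open>Of two closed sets covering the curve, one contains infinitely many \<gamma>(t) and
  hence everything. A proper closed subset is finite, so if irreducible it is a point, and no longer
  chain exists.\<close>

lemma irreducible_curve_curve: "irreducible_curve curve"
proof -
  have irr: "irreducible_closed curve"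
    unfolding irreducible_closed_def
  proof (intro conjI allI impI)
    fix A B assume AB: "zariski_closed A \<and> zariski_closed B \<and> curve \<subseteq> A \<union> B"
    then have "UNIV = {t. proj_pt (\<gamma> t) \<in> A} \<union> {t. proj_pt (\<gamma> t) \<in> B}"
      by (auto simp: curve_def)
    then have "infinite {t. proj_pt (\<gamma> t) \<in> A} \<or> infinite {t. proj_pt (\<gamma> t) \<in> B}"
      using infinite_UNIV_char_0[where 'a = complex] by (metis finite_UnI)
    then show "curve \<subseteq> A \<or> curve \<subseteq> B" using AB curve_subset_closed by blast
  qed (auto simp: zariski_closed_curve, simp add: curve_def)
  have "infinite (range (\<lambda>t. proj_pt (\<gamma> t)))"
    using inj_proj_\<gamma> by (simp add: finite_image_iff infinite_UNIV_char_0)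
  then have inf: "infinite curve" unfolding curve_def by simp
  have pt: "proj_pt (v d) \<in> curve" by (simp add: curve_def)
  then have "irreducible_closed {proj_pt (v d)}"
    using curve_subset by (auto intro!: irreducible_closed_singleton)
  moreover have "{proj_pt (v d)} \<subset> curve"
    using pt inf by (metis empty_subsetI finite.emptyI finite.insertI insert_subset psubsetI)
  moreover have False if Y: "irreducible_closed Y" and Z: "irreducible_closed Z" "Y \<subset> Z" "Z \<subset> curve"
    for Y Z
  proof -
    have "zariski_closed Z" using Z(1) by (simp add: irreducible_closed_def)
    then have "finite {t. proj_pt (\<gamma> t) \<in> Z}" using curve_subset_closed Z(3) by blast
    then have "finite (insert (proj_pt (v d)) ((\<lambda>t. proj_pt (\<gamma> t)) ` {t. proj_pt (\<gamma> t) \<in> Z}))" by simp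
    moreover have "Z \<subseteq> insert (proj_pt (v d)) ((\<lambda>t. proj_pt (\<gamma> t)) ` {t. proj_pt (\<gamma> t) \<in> Z})"
      using Z(3) by (auto simp: curve_def)
    ultimately have "finite Z" by (rule finite_subset[rotated])
    then obtain z where "Z = {z}" using Z(1) irreducible_closed_finite by blast
    moreover have "Y \<noteq> {}" using Y by (simp add: irreducible_closed_def)
    ultimately show False using Z(2) by blast
  qed
  ultimately show ?thesis unfolding irreducible_curve_def using irr by blast
qed

subsection \<open>The degree of the curve\<close>

text \<open>The Bezout determinant of a hyperplane section and its derivative plays the role of the
  discriminant; it also vanishes if the hyperplane passes through the point at infinity.\<close>

definition discr :: "'v cpoly" where
  "discr = bez_det d (\<lambda>l. lin_form (v l)) (\<lambda>l. lin_form (v (Suc l)))"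

text \<open>Differentiation shifts the sequence of derivatives; its new entry at index
  \<open>d\<close> is zero by \<open>v_gt\<close>.\<close>

lemma pderiv_pol: "pderiv (pol a) = exp_poly d (\<lambda>l. dotp a (v (Suc l)))"
proof (rule poly_eqI)
  fix n
  have "dotp a (v (Suc d)) = 0" by (simp add: v_gt dotp_def)
  then show "coeff (pderiv (pol a)) n = coeff (exp_poly d (\<lambda>l. dotp a (v (Suc l)))) n"
    by (cases "n = d") (auto simp: coeff_pderiv coeff_exp_poly field_simps simp del: of_nat_Suc)
qed

text \<open>The derivative, taken as a form of degree d, always vanishes at infinity; so infinity is
  a common zero exactly if the leading coefficient of \<open>pol a\<close> is zero.\<close>

lemma ceval_discr_nonzero_iff:
  "ceval a discr \<noteq> 0 \<longleftrightarrow>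
    dotp a (v d) \<noteq> 0 \<and> (\<forall>t. \<not> (poly (pol a) t = 0 \<and> poly (pderiv (pol a)) t = 0))"
proof -
  have "dotp a (v (Suc d)) = 0" by (simp add: v_gt dotp_def)
  then show ?thesis
    unfolding discr_def ceval.hom_bez_det ceval_lin_form pderiv_pol
    by (subst bez_det_eq_0_iff[OF d_pos]) auto
qed

lemma homogeneous_discr: "homogeneous (d * (1 + 1)) discr"
  unfolding discr_def by (intro homogeneous_bez_det homogeneous_lin_form)

text \<open>Changing the coefficient of the coordinate \<open>o\<^sub>0\<close> shifts \<^term>\<open>pol a\<close> by a constant,
  which can be chosen to avoid the finitely many critical values.\<close>

lemma discr_nonzero_ex: "\<exists>a. ceval a discr \<noteq> 0"
proof -
  obtain j where j: "v d j \<noteq> 0" using v_d by auto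
  then have jo: "j \<noteq> o\<^sub>0" using v_d_o by auto
  define e where "e = (\<lambda>i. if i = j then 1 else 0 :: complex)"
  have e: "dotp e (v l) = v l j" for l by (simp add: e_def dotp_unit)
  have deg: "degree (pol e) = d" using degree_exp_poly[of "\<lambda>l. dotp e (v l)" d] j by (simp add: e)
  then have "pderiv (pol e) \<noteq> 0" using d_pos by (simp add: pderiv_eq_0_iff)
  then have "finite ((\<lambda>t. - poly (pol e) t) ` {t. poly (pderiv (pol e)) t = 0})"
    using poly_roots_finite by blast
  then obtain c where c: "c \<notin> (\<lambda>t. - poly (pol e) t) ` {t. poly (pderiv (pol e)) t = 0}"
    using ex_new_if_finite[OF infinite_UNIV_char_0] by blast
  define a where "a = (\<lambda>i. e i + (if i = o\<^sub>0 then c else 0))"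
  have a: "dotp a (v l) = dotp e (v l) + c * v l o\<^sub>0" for l
    unfolding a_def dotp_add_left dotp_unit ..
  have "pol a = pol e + [:c:]"
    by (rule poly_eqI) (auto simp: coeff_exp_poly a v_0 v_pos coeff_pCons add_divide_distrib split: nat.split)
  then have "\<not> (poly (pol a) t = 0 \<and> poly (pderiv (pol a)) t = 0)" for t
    using c by (auto simp: pderiv_add pderiv_pCons image_iff add_eq_0_iff)
  moreover have "dotp a (v d) \<noteq> 0" using j by (simp add: a e v_d_o)
  ultimately show ?thesis unfolding ceval_discr_nonzero_iff by blast
qed

text \<open>A squarefree complex polynomial of degree d is a product of d distinct linear
  factors.\<close>

lemma card_roots:
  assumes "ceval a discr \<noteq> 0"
  shows "card {t. dotp a (\<gamma> t) = 0} = d"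
proof -
  have deg: "degree (pol a) = d" and sq: "rsquarefree (pol a)"
    using assms unfolding ceval_discr_nonzero_iff
    by (auto simp: degree_exp_poly[of "\<lambda>l. dotp a (v l)"] rsquarefree_roots)
  have "pol a \<noteq> 0" using deg d_pos by (metis degree_0 less_irrefl)
  then have lc: "lead_coeff (pol a) \<noteq> 0" by simp
  have "d = degree (smult (lead_coeff (pol a)) (\<Prod>z | poly (pol a) z = 0. [:-z, 1:]))"
    by (subst complex_poly_decompose_rsquarefree[OF sq]) (simp add: deg)
  also have "\<dots> = degree (\<Prod>z | poly (pol a) z = 0. [:-z, 1:])" using lc by simp
  also have "\<dots> = (\<Sum>z | poly (pol a) z = 0. degree [:-z, 1:])" by (intro degree_prod_eq_sum_degree) auto
  finally show ?thesis by (simp add: poly_pol)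
qed

text \<open>Where the discriminant is nonzero the hyperplane misses the point at infinity, and its
  section is the injective image of d simple roots.\<close>

lemma has_degree_curve: "has_degree curve d"
  unfolding has_degree_def
proof (intro exI conjI ballI)
  show "homogeneous (d * (1 + 1)) discr" by (rule homogeneous_discr)
  show "discr \<noteq> 0" using discr_nonzero_ex by auto
  fix \<alpha> assume \<alpha>: "\<alpha> \<in> proj_space - proj_zeros {discr}"
  then obtain a where a: "\<alpha> = proj_pt a" "a \<noteq> (\<lambda>_. 0)" by (auto elim: proj_spaceE)
  have D: "ceval a discr \<noteq> 0"
    using \<alpha> a proj_pt_in_zeros[of "{discr}" a] homogeneous_discr by auto
  then have vd: "dotp a (v d) \<noteq> 0" by (simp add: ceval_discr_nonzero_iff)
  have eq: "curve \<inter> hyperplane \<alpha> = (\<lambda>t. proj_pt (\<gamma> t)) ` {t. dotp a (\<gamma> t) = 0}"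
    using vd by (auto simp: a(1) curve_def proj_pt_in_hyperplane \<gamma>_nonzero)
  show "finite (curve \<inter> hyperplane \<alpha>)" unfolding eq using finite_roots[OF vd] by simp
  have "inj_on (\<lambda>t. proj_pt (\<gamma> t)) {t. dotp a (\<gamma> t) = 0}"
    using inj_proj_\<gamma> by (rule inj_on_subset) simp
  then show "card (curve \<inter> hyperplane \<alpha>) = d" unfolding eq by (simp add: card_image card_roots[OF D])
qed

subsection \<open>The Chow form\<close>

definition chow_form :: "('v + 'v) cpoly" where
  "chow_form = bez_det d (\<lambda>l. \<Sum>j\<in>UNIV. cvar (Inl j) * cconst (v l j))
     (\<lambda>l. \<Sum>j\<in>UNIV. cvar (Inr j) * cconst (v l j))"

lemma ceval_chow_form: "ceval (case_sum a b) chow_form = bez a b"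
  by (simp add: chow_form_def ceval.hom_bez_det ceval.hom_sum ceval_mult dotp_def)

lemma bihomogeneous_chow_form: "bihomogeneous d d chow_form"
proof -
  have L: "homog_wt left_wt 1 (\<Sum>j\<in>UNIV. cvar (Inl j :: 'v + 'v) * cconst (v l j))"
    "homog_wt left_wt 0 (\<Sum>j\<in>UNIV. cvar (Inr j :: 'v + 'v) * cconst (v l j))" for l
    by (rule left.homog_wt_lin, simp add: lookup_single when_def)+
  have R: "homog_wt right_wt 0 (\<Sum>j\<in>UNIV. cvar (Inl j :: 'v + 'v) * cconst (v l j))"
    "homog_wt right_wt 1 (\<Sum>j\<in>UNIV. cvar (Inr j :: 'v + 'v) * cconst (v l j))" for l
    by (rule right.homog_wt_lin, simp add: lookup_single when_def)+
  show ?thesis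
    using left.homog_wt_bez_det[OF L] right.homog_wt_bez_det[OF R]
    by (simp add: bihomogeneous_iff chow_form_def)
qed

lemma biproj_zeros_chow_form: "biproj_zeros chow_form = chow_hypersurface curve"
proof (rule Set.set_eqI, clarify)
  fix \<alpha> \<beta> :: "'v ppoint"
  show "(\<alpha>, \<beta>) \<in> biproj_zeros chow_form \<longleftrightarrow> (\<alpha>, \<beta>) \<in> chow_hypersurface curve"
  proof (cases "\<alpha> \<in> proj_space \<and> \<beta> \<in> proj_space")
    case True
    then obtain a b where ab: "\<alpha> = proj_pt a" "a \<noteq> (\<lambda>_. 0)" "\<beta> = proj_pt b" "b \<noteq> (\<lambda>_. 0)"
      by (metis proj_spaceE)
    have "(\<alpha>, \<beta>) \<in> biproj_zeros chow_form \<longleftrightarrow> bez a b = 0"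
      unfolding ab(1,3) proj_pt_in_biproj_zeros[OF bihomogeneous_chow_form] ceval_chow_form
      using ab(2,4) by simp
    also have "\<dots> \<longleftrightarrow> (\<exists>y\<in>curve. y \<in> hyperplane \<alpha> \<and> y \<in> hyperplane \<beta>)"
      unfolding bez_eq_0_iff by (auto simp: curve_def ab(1,3) proj_pt_in_hyperplane v_d \<gamma>_nonzero)
    also have "\<dots> \<longleftrightarrow> (\<alpha>, \<beta>) \<in> chow_hypersurface curve"
      using True by (auto simp: chow_hypersurface_def)
    finally show ?thesis .
  next
    case False
    then show ?thesis by (auto simp: biproj_zeros_def chow_hypersurface_def)
  qed
qed

text \<open>The hyperplane at infinity, which meets the curve only in the point \<open>v d\<close>;
  it is the reference point of the comparisons below.\<close>

abbreviation e\<^sub>0 :: "'v \<Rightarrow> complex" where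
  "e\<^sub>0 \<equiv> \<lambda>i. if i = o\<^sub>0 then 1 else 0"

lemma dotp_e0: "dotp e\<^sub>0 (\<gamma> t) = 1" "dotp e\<^sub>0 (v d) = 0"
  by (simp_all add: dotp_unit \<gamma>_o v_d_o)

lemma bez_e0_nonzero: "dotp a (v d) \<noteq> 0 \<Longrightarrow> bez a e\<^sub>0 \<noteq> 0"
  unfolding bez_eq_0_iff by (simp add: dotp_e0)

lemma chow_form_nonzero: "chow_form \<noteq> 0"
proof -
  obtain a where "dotp a (v d) \<noteq> 0"
    using discr_nonzero_ex ceval_discr_nonzero_iff by blast
  then have "ceval (case_sum a e\<^sub>0) chow_form \<noteq> 0"
    unfolding ceval_chow_form by (rule bez_e0_nonzero)
  then show ?thesis by auto
qed

section \<open>Uniqueness of the equation up to a scalar\<close>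

text \<open>Stated for functions rather than polynomials, so that the two sets of variables can be
  exchanged freely.\<close>

definition chow_vanishing :: "(('v \<Rightarrow> complex) \<Rightarrow> ('v \<Rightarrow> complex) \<Rightarrow> complex) \<Rightarrow> bool" where
  "chow_vanishing q \<longleftrightarrow>
     (\<forall>a b c. \<exists>r. degree r \<le> d \<and> (\<forall>s. q a (\<lambda>i. b i + s * c i) = poly r s)) \<and>
     (\<forall>a b c. \<exists>r. degree r \<le> d \<and> (\<forall>s. q (\<lambda>i. b i + s * c i) a = poly r s)) \<and>
     (\<forall>a b. bez a b = 0 \<longrightarrow> q a b = 0)"

lemma bez_swap: "bez a b = 0 \<longleftrightarrow> bez b a = 0"
  unfolding bez_eq_0_iff by blast

lemma chow_vanishing_swap: "chow_vanishing q \<Longrightarrow> chow_vanishing (\<lambda>a b. q b a)"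
  unfolding chow_vanishing_def using bez_swap by blast

lemma chow_vanishing_lines:
  assumes "chow_vanishing q"
  shows "poly_on_lines (q a)" "poly_on_lines (\<lambda>a. q a b)"
  using assms unfolding chow_vanishing_def poly_on_lines_def by blast+

text \<open>Along a line in one group of variables only that group contributes to the degree, and
  its partial degree is d.\<close>

lemma chow_vanishing_ceval:
  assumes Q: "bihomogeneous d d Q" and zero: "\<And>a b. bez a b = 0 \<Longrightarrow> ceval (case_sum a b) Q = 0"
  shows "chow_vanishing (\<lambda>a b. ceval (case_sum a b) Q)"
  unfolding chow_vanishing_def
proof (intro conjI allI impI)
  fix a b c :: "'v \<Rightarrow> complex"
  have deg: "degree [:b i, c i:] \<le> 1" for i by simp
  show "\<exists>r. degree r \<le> d \<and> (\<forall>s. ceval (case_sum a (\<lambda>i. b i + s * c i)) Q = poly r s)"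
  proof -
    let ?c = "case_sum (\<lambda>i. [:a i:]) (\<lambda>i. [:b i, c i:])"
    have "(\<Sum>i\<in>UNIV. Poly_Mapping.lookup m i * degree (?c i)) \<le> d" if "m \<in> Poly_Mapping.keys Q" for m
    proof -
      have "(\<Sum>i\<in>UNIV. Poly_Mapping.lookup m i * degree (?c i)) \<le> right_wt m"
        unfolding sum_UNIV_sum using mult_le_mono2[OF deg] by (auto intro!: sum_mono)
      then show ?thesis using Q that by (auto simp: bihomogeneous_def)
    qed
    then obtain r where "degree r \<le> d" "\<And>s. ceval (\<lambda>i. poly (?c i) s) Q = poly r s"
      using ceval_poly_curve by blast
    moreover have "(\<lambda>i. poly (?c i) s) = case_sum a (\<lambda>i. b i + s * c i)" for s
      by (auto simp: fun_eq_iff split: sum.split)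
    ultimately show ?thesis by auto
  qed
  show "\<exists>r. degree r \<le> d \<and> (\<forall>s. ceval (case_sum (\<lambda>i. b i + s * c i) a) Q = poly r s)"
  proof -
    let ?c = "case_sum (\<lambda>i. [:b i, c i:]) (\<lambda>i. [:a i:])"
    have "(\<Sum>i\<in>UNIV. Poly_Mapping.lookup m i * degree (?c i)) \<le> d" if "m \<in> Poly_Mapping.keys Q" for m
    proof -
      have "(\<Sum>i\<in>UNIV. Poly_Mapping.lookup m i * degree (?c i)) \<le> left_wt m"
        unfolding sum_UNIV_sum using mult_le_mono2[OF deg] by (auto intro!: sum_mono)
      then show ?thesis using Q that by (auto simp: bihomogeneous_def)
    qed
    then obtain r where "degree r \<le> d" "\<And>s. ceval (\<lambda>i. poly (?c i) s) Q = poly r s"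
      using ceval_poly_curve by blast
    moreover have "(\<lambda>i. poly (?c i) s) = case_sum (\<lambda>i. b i + s * c i) a" for s
      by (auto simp: fun_eq_iff split: sum.split)
    ultimately show ?thesis by auto
  qed
qed (rule zero)

lemma chow_vanishing_bez: "chow_vanishing bez"
  using chow_vanishing_ceval[OF bihomogeneous_chow_form] by (simp add: ceval_chow_form)

text \<open>If the hyperplane \<open>a\<close> meets the curve in \<open>d\<close> points \<open>\<gamma> t\<close> that are separated by \<open>b\<close>, then
  on the line from \<open>b\<close> to \<open>e\<^sub>0\<close> both functions have \<open>d\<close> common zeros.\<close>

lemma chow_vanishing_proportional_generic:
  assumes q: "chow_vanishing q" and p: "chow_vanishing p" and a: "ceval a discr \<noteq> 0"
  shows "q a b * p a e\<^sub>0 = p a b * q a e\<^sub>0"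
proof -
  define T where "T = {t. dotp a (\<gamma> t) = 0}"
  have card_T: "card T = d" unfolding T_def by (rule card_roots[OF a])
  then have fin_T: "finite T" using d_pos card_ge_0_finite by metis
  \<comment> \<open>Genericity conditions on \<open>b\<close>: off the diagonal they separate the
    points of the section, on the diagonal they make the line from \<open>b\<close> to
    \<open>e\<^sub>0\<close> meet the condition imposed by each point.\<close>
  define h where "h = (\<lambda>(t, t') b. if t = t' then dotp b (\<gamma> t) - 1 else dotp b (\<gamma> t) - dotp b (\<gamma> t'))"
  have h_lines: "poly_on_lines (h i)" for i
    unfolding h_def by (cases i; cases "fst i = snd i")
      (auto intro!: poly_on_lines_diff poly_on_lines_dotp poly_on_lines_const)
  have "\<exists>x. h i x \<noteq> 0" for i
  proof (cases i)
    case (Pair t t')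
    show ?thesis
    proof (cases "t = t'")
      case True
      then show ?thesis unfolding Pair h_def
        by (intro exI[of _ "\<lambda>_. 0"]) (simp add: dotp_zero_left)
    next
      case False
      then have "\<gamma> t \<noteq> \<gamma> t'" using inj_\<gamma> by (auto simp: inj_def)
      then obtain j where "\<gamma> t j \<noteq> \<gamma> t' j" by auto
      then show ?thesis unfolding Pair h_def using False
        by (intro exI[of _ "\<lambda>k. if k = j then 1 else 0"]) (simp add: dotp_unit)
    qed
  qed
  then have "\<exists>x. \<forall>i\<in>T \<times> T. h i x \<noteq> 0"
    using poly_on_lines_nonzero_ex[of "T \<times> T" h] fin_T h_lines by blast
  then obtain x where x: "(\<Prod>i\<in>T \<times> T. h i x) \<noteq> 0" using fin_T by auto
  \<comment> \<open>By density it is enough to treat those \<open>b\<close> that satisfy the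
    conditions \<open>h\<close>.\<close>
  have "q a b * p a e\<^sub>0 - p a b * q a e\<^sub>0 = 0"
  proof (rule poly_on_lines_eq_0[where f = "\<lambda>b. q a b * p a e\<^sub>0 - p a b * q a e\<^sub>0"
        and g = "\<lambda>b. \<Prod>i\<in>T \<times> T. h i b" and b = x and x = b])
    show "poly_on_lines (\<lambda>b. q a b * p a e\<^sub>0 - p a b * q a e\<^sub>0)"
      using chow_vanishing_lines[OF q] chow_vanishing_lines[OF p]
      by (intro poly_on_lines_diff poly_on_lines_mult poly_on_lines_const)
    show "poly_on_lines (\<lambda>b. \<Prod>i\<in>T \<times> T. h i b)" by (intro poly_on_lines_prod h_lines)
    show "(\<Prod>i\<in>T \<times> T. h i x) \<noteq> 0" by (rule x)
  next
    fix b assume "(\<Prod>i\<in>T \<times> T. h i b) \<noteq> 0"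
    then have h: "\<And>t t'. t \<in> T \<Longrightarrow> t' \<in> T \<Longrightarrow> h (t, t') b \<noteq> 0" using fin_T by auto
    have ne1: "dotp b (\<gamma> t) \<noteq> 1" if "t \<in> T" for t
      using h[OF that that] by (simp add: h_def)
    have sep: "dotp b (\<gamma> t) \<noteq> dotp b (\<gamma> t')" if "t \<in> T" "t' \<in> T" "t \<noteq> t'" for t t'
      using h[OF that(1,2)] that(3) by (simp add: h_def)
    define c where "c = (\<lambda>i. e\<^sub>0 i - b i)"
    \<comment> \<open>The parameter at which the hyperplane on the line passes through \<gamma>(t),
      solved from z + s (1 - z) = 0 with z the value of \<open>b\<close> at \<gamma>(t).\<close>
    define s where "s t = dotp b (\<gamma> t) / (dotp b (\<gamma> t) - 1)" for t
    have "inj_on s T"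
    proof (rule inj_onI, rule ccontr)
      fix t t' assume t: "t \<in> T" "t' \<in> T" "s t = s t'" "t \<noteq> t'"
      have "dotp b (\<gamma> t) * (dotp b (\<gamma> t') - 1) = dotp b (\<gamma> t') * (dotp b (\<gamma> t) - 1)"
        using t(3) ne1[OF t(1)] ne1[OF t(2)] by (simp add: s_def frac_eq_eq)
      then show False using sep[OF t(1,2,4)] by (simp add: algebra_simps)
    qed
    then have card_S: "card (s ` T) = d" by (simp add: card_image card_T)
    have bez0: "bez a (\<lambda>i. b i + s t * c i) = 0" if "t \<in> T" for t
    proof -
      have "dotp (\<lambda>i. b i + s t * c i) (\<gamma> t) = dotp b (\<gamma> t) + s t * (1 - dotp b (\<gamma> t))"
        unfolding c_def dotp_add_left dotp_scale_left dotp_diff_left dotp_e0 ..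
      also have "\<dots> = 0" using ne1[OF that] by (simp add: s_def field_simps)
      finally show ?thesis unfolding bez_eq_0_iff using that by (auto simp: T_def)
    qed
    obtain r where r: "degree r \<le> d" "\<And>s. q a (\<lambda>i. b i + s * c i) = poly r s"
      using q unfolding chow_vanishing_def by metis
    obtain r' where r': "degree r' \<le> d" "\<And>s. p a (\<lambda>i. b i + s * c i) = poly r' s"
      using p unfolding chow_vanishing_def by metis
    have "poly r u = 0 \<and> poly r' u = 0" if "u \<in> s ` T" for u
      using that bez0 q p unfolding chow_vanishing_def by (auto simp flip: r(2) r'(2))
    \<comment> \<open>The line is at \<open>b\<close> for the parameter 0 and at
      \<open>e\<^sub>0\<close> for 1.\<close>
    then have "poly r 0 * poly r' 1 = poly r' 0 * poly r 1"
      using r(1) r'(1) fin_T by (intro poly_proportional[of r' "s ` T" r]) (auto simp: card_S)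
    then show "q a b * p a e\<^sub>0 - p a b * q a e\<^sub>0 = 0"
      by (simp add: c_def flip: r(2) r'(2))
  qed
  then show ?thesis by simp
qed

text \<open>For generic \<open>a\<close> both \<open>b\<close> and \<open>b'\<close> are compared
  with \<open>e\<^sub>0\<close>, where \<open>p\<close> is nonzero; density gives all
  \<open>a\<close>. A general \<open>p\<close> is allowed so that \<open>bez\<close> with exchanged
  arguments qualifies too.\<close>

lemma chow_vanishing_proportional:
  assumes q: "chow_vanishing q" and p: "chow_vanishing p" "\<And>a b. p a b = 0 \<longleftrightarrow> bez a b = 0"
  shows "q a b * p a b' = p a b * q a b'"
proof -
  obtain a0 where a0: "ceval a0 discr \<noteq> 0" using discr_nonzero_ex by blast
  have "q a b * p a b' - p a b * q a b' = 0"
  proof (rule poly_on_lines_eq_0[where f = "\<lambda>a. q a b * p a b' - p a b * q a b'"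
        and g = "\<lambda>a. ceval a discr" and b = a0 and x = a])
    show "poly_on_lines (\<lambda>a. q a b * p a b' - p a b * q a b')"
      by (intro poly_on_lines_diff poly_on_lines_mult chow_vanishing_lines[OF q]
          chow_vanishing_lines[OF p(1)])
  next
    fix a assume a: "ceval a discr \<noteq> 0"
    then have "p a e\<^sub>0 \<noteq> 0" using bez_e0_nonzero p(2) by (simp add: ceval_discr_nonzero_iff)
    moreover have "(q a b * p a e\<^sub>0) * p a b' = p a b * (q a b' * p a e\<^sub>0)"
      unfolding chow_vanishing_proportional_generic[OF q p(1) a] by simp
    ultimately show "q a b * p a b' - p a b * q a b' = 0" by simp
  qed (simp_all add: a0 poly_on_lines_ceval)
  then show ?thesis by simp
qed

text \<open>The ratio of \<open>q\<close> to \<open>bez\<close> is independent of \<open>b\<close>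
  by the first proportionality and, at \<open>e\<^sub>0\<close>, independent of \<open>a\<close> by
  the second, with exchanged arguments. Its value at a fixed pair is the constant.\<close>

lemma chow_vanishing_multiple:
  assumes q: "chow_vanishing q"
  shows "\<exists>c. \<forall>a b. q a b = c * bez a b"
proof -
  obtain a0 where a0: "bez a0 e\<^sub>0 \<noteq> 0"
    using discr_nonzero_ex ceval_discr_nonzero_iff bez_e0_nonzero by blast
  note p = chow_vanishing_bez
  have 1: "q a b * bez a e\<^sub>0 = bez a b * q a e\<^sub>0" for a b
    using chow_vanishing_proportional[OF q p] by blast
  have 2: "q a e\<^sub>0 * bez a0 e\<^sub>0 = bez a e\<^sub>0 * q a0 e\<^sub>0" for a
    using chow_vanishing_proportional[OF chow_vanishing_swap[OF q] chow_vanishing_swap[OF p],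
        where a = e\<^sub>0 and b = a and b' = a0] bez_swap by blast
  have "q a b * bez a0 e\<^sub>0 - bez a b * q a0 e\<^sub>0 = 0" for a b
  proof (rule poly_on_lines_eq_0[where f = "\<lambda>a. q a b * bez a0 e\<^sub>0 - bez a b * q a0 e\<^sub>0"
        and g = "\<lambda>a. bez a e\<^sub>0" and b = a0 and x = a])
    show "poly_on_lines (\<lambda>a. q a b * bez a0 e\<^sub>0 - bez a b * q a0 e\<^sub>0)"
      by (intro poly_on_lines_diff poly_on_lines_mult chow_vanishing_lines(2)[OF q]
          chow_vanishing_lines(2)[OF p] poly_on_lines_const)
    show "poly_on_lines (\<lambda>a. bez a e\<^sub>0)" by (rule chow_vanishing_lines(2)[OF p])
    show "bez a0 e\<^sub>0 \<noteq> 0" by (rule a0)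
  next
    fix a assume a: "bez a e\<^sub>0 \<noteq> 0"
    have "(q a b * bez a e\<^sub>0) * bez a0 e\<^sub>0 = bez a b * (q a e\<^sub>0 * bez a0 e\<^sub>0)"
      unfolding 1 by simp
    also have "\<dots> = bez a b * q a0 e\<^sub>0 * bez a e\<^sub>0" unfolding 2 by simp
    finally show "q a b * bez a0 e\<^sub>0 - bez a b * q a0 e\<^sub>0 = 0" using a by simp
  qed
  then have "q a b = q a0 e\<^sub>0 / bez a0 e\<^sub>0 * bez a b" for a b
    using a0 by (simp add: field_simps)
  then show ?thesis by blast
qed

text \<open>Any equation of the hypersurface vanishes wherever \<open>bez\<close> does and is
  therefore a scalar multiple of the Chow form.\<close>

theorem chow_point_curve: "chow_point curve = cpoly_class chow_form"
proof (intro equalityI subsetI)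
  fix Q assume Q: "Q \<in> chow_point curve"
  then have bi: "bihomogeneous d d Q" and "Q \<noteq> 0" and zeros: "biproj_zeros Q = biproj_zeros chow_form"
    using has_degree_unique[OF has_degree_curve] biproj_zeros_chow_form
    by (auto simp: chow_point_def)
  have "ceval (case_sum a b) Q = 0" if "bez a b = 0" for a b
  proof (cases "a = (\<lambda>_. 0) \<or> b = (\<lambda>_. 0)")
    case True
    \<comment> \<open>Zero vectors are not projective points; there \<open>Q\<close> vanishes by
      bihomogeneity of positive degree.\<close>
    have "ceval (case_sum (\<lambda>i. 0 * a i) (\<lambda>i. 1 * b i)) Q = 0"
      "ceval (case_sum (\<lambda>i. 1 * a i) (\<lambda>i. 0 * b i)) Q = 0"
      unfolding ceval_biscale[OF bi] using d_pos by simp_all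
    then show ?thesis using True by (elim disjE) simp_all
  next
    case False
    then have "(proj_pt a, proj_pt b) \<in> biproj_zeros chow_form"
      using that unfolding proj_pt_in_biproj_zeros[OF bihomogeneous_chow_form] ceval_chow_form by simp
    then show ?thesis
      unfolding zeros[symmetric] proj_pt_in_biproj_zeros[OF bi] by simp
  qed
  then obtain c where c: "\<And>a b. ceval (case_sum a b) Q = c * bez a b"
    using chow_vanishing_multiple[OF chow_vanishing_ceval[OF bi]] by blast
  have eq: "Q = cconst c * chow_form"
  proof (rule ceval_ext)
    fix x :: "'v + 'v \<Rightarrow> complex"
    have x: "x = case_sum (x \<circ> Inl) (x \<circ> Inr)" by (auto simp: fun_eq_iff split: sum.split)
    show "ceval x Q = ceval x (cconst c * chow_form)"
      by (subst (1 2) x) (simp only: c ceval_mult ceval_cconst ceval_chow_form)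
  qed
  moreover have "c \<noteq> 0" using eq \<open>Q \<noteq> 0\<close> by (auto simp: cconst_def)
  ultimately show "Q \<in> cpoly_class chow_form" by (auto simp: cpoly_class_def)
next
  fix Q assume "Q \<in> cpoly_class chow_form"
  then obtain c where c: "c \<noteq> 0" "Q = cconst c * chow_form" by (auto simp: cpoly_class_def)
  have ev: "ceval x Q = c * ceval x chow_form" for x by (simp add: c(2) ceval_mult)
  obtain x where "ceval x chow_form \<noteq> 0" using chow_form_nonzero by (rule ceval_nonzero_ex)
  then have "ceval x Q \<noteq> 0" using c(1) by (simp add: ev)
  then have "Q \<noteq> 0" by auto
  moreover have "bihomogeneous d d Q"
    using bihomogeneous_chow_form left.homog_wt_mult[OF left.homog_wt_cconst, of d chow_form c]
      right.homog_wt_mult[OF right.homog_wt_cconst, of d chow_form c]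
    unfolding bihomogeneous_iff c(2) by simp
  moreover have "biproj_zeros Q = biproj_zeros chow_form"
    using c(1) by (simp add: biproj_zeros_def ev)
  ultimately show "Q \<in> chow_point curve"
    using irreducible_curve_curve has_degree_curve biproj_zeros_chow_form
    by (auto simp: chow_point_def)
qed

end

subsection \<open>Locally nilpotent derivations\<close>

locale lnd =
  fixes \<delta> :: "('n::finite) cpoly \<Rightarrow> 'n cpoly"
  assumes derivation: "derivation \<delta>" and nilpotent: "locally_nilpotent \<delta>"
begin

lemma \<delta>_add: "\<delta> (p + q) = \<delta> p + \<delta> q"
  and \<delta>_scale: "\<delta> (cconst c * p) = cconst c * \<delta> p"
  and \<delta>_mult: "\<delta> (p * q) = \<delta> p * q + p * \<delta> q"
  using derivation by (auto simp: derivation_def)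

lemma \<delta>_0: "\<delta> 0 = 0"
  using \<delta>_add[of 0 0] by simp

lemma \<delta>_1: "\<delta> 1 = 0"
  using \<delta>_mult[of 1 1] by simp

lemma \<delta>_cconst: "\<delta> (cconst c) = 0"
  using \<delta>_scale[of c 1] by (simp add: \<delta>_1)

lemma iter_0: "(\<delta> ^^ n) 0 = 0"
  by (induction n) (simp_all add: \<delta>_0)

lemma iter_add: "(\<delta> ^^ n) (p + q) = (\<delta> ^^ n) p + (\<delta> ^^ n) q"
  by (induction n) (simp_all add: \<delta>_add)

lemma iter_cconst: "n > 0 \<Longrightarrow> (\<delta> ^^ n) (cconst c) = 0"
proof (induction n)
  case (Suc n)
  then show ?case by (cases n) (simp_all add: \<delta>_cconst \<delta>_0)
qed simp

lemma iter_eq_0_mono: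
  assumes "(\<delta> ^^ m) p = 0" "m \<le> n"
  shows "(\<delta> ^^ n) p = 0"
proof -
  have "(\<delta> ^^ n) p = (\<delta> ^^ (n - m)) ((\<delta> ^^ m) p)"
    using assms(2) by (simp flip: comp_apply[of "\<delta> ^^ _"] funpow_add)
  then show ?thesis by (simp add: assms(1) iter_0)
qed

text \<open>There are finitely many variables, so a common exponent exists and the minimum in
  \<open>lnd_degree\<close> is attained.\<close>

lemma funpow_lnd_degree: "(\<delta> ^^ (lnd_degree \<delta> + 1)) (cvar j) = 0"
proof -
  have "\<exists>m. \<forall>j. (\<delta> ^^ m j) (cvar j) = 0"
    by (rule choice) (use nilpotent in \<open>simp add: locally_nilpotent_def\<close>)
  then obtain m where m: "\<And>j. (\<delta> ^^ m j) (cvar j) = 0" by blast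
  have "\<forall>j. (\<delta> ^^ (Max (range m) + 1)) (cvar j) = 0"
    using iter_eq_0_mono[OF m] by (simp add: le_SucI del: funpow.simps)
  then have "\<forall>j. (\<delta> ^^ (lnd_degree \<delta> + 1)) (cvar j) = 0"
    unfolding lnd_degree_def by (rule LeastI)
  then show ?thesis by blast
qed

section \<open>Orbits as polynomial curves\<close>

text \<open>The polynomial \<open>t \<mapsto> p(-t.x)\<close>.\<close>

definition orbit_poly :: "('n \<Rightarrow> complex) \<Rightarrow> 'n cpoly \<Rightarrow> complex poly" where
  "orbit_poly x p = Abs_poly (\<lambda>j. ceval x ((\<delta> ^^ j) p) / fact j)"

lemma coeff_orbit_poly: "coeff (orbit_poly x p) j = ceval x ((\<delta> ^^ j) p) / fact j"
proof -
  obtain m where "(\<delta> ^^ m) p = 0" using nilpotent unfolding locally_nilpotent_def by blast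
  then have "ceval x ((\<delta> ^^ j) p) / fact j = 0" if "j > m" for j
    using iter_eq_0_mono[of m p j] that by simp
  then show ?thesis unfolding orbit_poly_def by (subst coeff_Abs_poly[of m]) auto
qed

lemma orbit_poly_add: "orbit_poly x (p + q) = orbit_poly x p + orbit_poly x q"
  by (rule poly_eqI) (simp add: coeff_orbit_poly iter_add ceval_add add_divide_distrib)

lemma orbit_poly_cconst: "orbit_poly x (cconst c) = [:c:]"
  by (rule poly_eqI) (auto simp: coeff_orbit_poly coeff_pCons iter_cconst simp del: funpow.simps(2) split: nat.split)

text \<open>Along the orbit the derivation becomes d/dt.\<close>

lemma pderiv_orbit_poly: "pderiv (orbit_poly x p) = orbit_poly x (\<delta> p)"
  by (rule poly_eqI)
    (simp add: coeff_pderiv coeff_orbit_poly funpow_Suc_right field_simps del: funpow.simps(2) of_nat_Suc)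

text \<open>Both sides satisfy the product rule, so their coefficients agree by induction.\<close>

lemma orbit_poly_mult: "orbit_poly x (p * q) = orbit_poly x p * orbit_poly x q"
proof (rule poly_eqI)
  fix n
  show "coeff (orbit_poly x (p * q)) n = coeff (orbit_poly x p * orbit_poly x q) n"
  proof (induction n arbitrary: p q)
    case 0
    show ?case by (simp add: coeff_mult coeff_orbit_poly ceval_mult)
  next
    case (Suc n)
    have "of_nat (Suc n) * coeff (orbit_poly x (p * q)) (Suc n) = coeff (pderiv (orbit_poly x (p * q))) n"
      by (simp only: coeff_pderiv)
    also have "\<dots> = coeff (orbit_poly x (\<delta> p * q)) n + coeff (orbit_poly x (p * \<delta> q)) n"
      by (simp add: pderiv_orbit_poly \<delta>_mult orbit_poly_add)
    also have "\<dots> = coeff (pderiv (orbit_poly x p * orbit_poly x q)) n"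
      by (simp add: Suc.IH pderiv_mult pderiv_orbit_poly mult.commute add.commute)
    also have "\<dots> = of_nat (Suc n) * coeff (orbit_poly x p * orbit_poly x q) (Suc n)"
      by (simp only: coeff_pderiv)
    finally show ?case by (simp del: of_nat_Suc)
  qed
qed

text \<open>For fixed t the left side is a ring homomorphism fixing constants, hence evaluation at
  the point -t.x.\<close>

lemma poly_orbit_poly: "poly (orbit_poly x p) t = ceval (\<lambda>k. poly (orbit_poly x (cvar k)) t) p"
proof (rule ring_hom_eq_ceval)
  show "comm_ring_hom (\<lambda>p. poly (orbit_poly x p) t)"
  proof
    show "poly (orbit_poly x 0) t = 0" "poly (orbit_poly x 1) t = 1"
      using orbit_poly_cconst[of x 0] orbit_poly_cconst[of x 1] by (simp_all add: cconst_def)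
  qed (simp_all add: orbit_poly_add orbit_poly_mult)
qed (simp add: orbit_poly_cconst)

lemma orbit_poly_cvar:
  "orbit_poly x (cvar k) = exp_poly (lnd_degree \<delta>) (\<lambda>l. ceval x ((\<delta> ^^ l) (cvar k)))"
  using iter_eq_0_mono[OF funpow_lnd_degree]
  by (intro poly_eqI) (auto simp: coeff_orbit_poly coeff_exp_poly not_le Suc_le_eq simp del: funpow.simps)

lemma lnd_action_eq: "lnd_action \<delta> t x k = poly (orbit_poly x (cvar k)) (- t)"
proof -
  have "lnd_action \<delta> t x k =
      (\<Sum>j\<le>lnd_degree \<delta>. (- t) ^ j / fact j * ceval x ((\<delta> ^^ j) (cvar k)))"
    unfolding lnd_action_def using iter_eq_0_mono[OF funpow_lnd_degree]
    by (intro suminf_finite) (auto simp: not_le Suc_le_eq simp del: funpow.simps)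
  then show ?thesis by (simp add: orbit_poly_cvar poly_exp_poly mult.commute)
qed

text \<open>In degree 0 all coordinates are constant along orbits, so the parameter 1 would act
  trivially.\<close>

lemma lnd_degree_pos:
  assumes "free_action (lnd_action \<delta>)"
  shows "lnd_degree \<delta> > 0"
proof (rule ccontr)
  assume "\<not> lnd_degree \<delta> > 0"
  then have "lnd_action \<delta> 1 x = x" for x
    by (simp add: fun_eq_iff lnd_action_eq orbit_poly_cvar poly_exp_poly)
  then show False using assms unfolding free_action_def by (metis zero_neq_one)
qed

text \<open>The function \<open>\<delta>\<^sup>d\<^sup>-\<^sup>1 x\<^sub>k\<close> restricts to a nonconstant affine function of \<open>t\<close> on the orbit.\<close>

lemma orbit_inj:
  assumes d: "lnd_degree \<delta> > 0" and k: "ceval x ((\<delta> ^^ lnd_degree \<delta>) (cvar k)) \<noteq> 0"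
    and eq: "\<And>j. poly (orbit_poly x (cvar j)) s = poly (orbit_poly x (cvar j)) t"
  shows "s = t"
proof -
  obtain e where e: "lnd_degree \<delta> = Suc e" using d by (cases "lnd_degree \<delta>") auto
  let ?p = "(\<delta> ^^ e) (cvar k)"
  have pow: "(\<delta> ^^ j) ?p = (\<delta> ^^ (e + j)) (cvar k)" for j
    by (subst add.commute) (simp add: funpow_add)
  have "orbit_poly x ?p = [:ceval x ?p, ceval x ((\<delta> ^^ Suc e) (cvar k)):]"
  proof (rule poly_eqI)
    fix j
    have "(\<delta> ^^ (e + j)) (cvar k) = 0" if "j > 1"
      using iter_eq_0_mono[OF funpow_lnd_degree] that e by simp
    then show "coeff (orbit_poly x ?p) j = coeff [:ceval x ?p, ceval x ((\<delta> ^^ Suc e) (cvar k)):] j"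
      unfolding coeff_orbit_poly pow by (cases j; cases "j - 1") (auto simp: coeff_pCons split: nat.split)
  qed
  \<comment> \<open>The value of any polynomial depends only on the point of the orbit, and the two
    points agree by \<open>eq\<close>.\<close>
  moreover have "poly (orbit_poly x ?p) s = poly (orbit_poly x ?p) t"
    unfolding poly_orbit_poly[of x ?p] eq ..
  ultimately show ?thesis using k unfolding e by simp
qed

end

section \<open>The Chow point of a generic orbit\<close>

theorem theorem1:
  fixes \<delta> :: "('n::finite) cpoly \<Rightarrow> 'n cpoly"
    and d :: nat
    and x :: "'n \<Rightarrow> complex"
  assumes "derivation \<delta>"
    and "locally_nilpotent \<delta>"
    and "free_action (lnd_action \<delta>)"
    and "d = lnd_degree \<delta>"
    and "\<exists>j. ceval x ((\<delta> ^^ d) (cvar j)) \<noteq> 0"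
  shows "chow_point (orbit_closure \<delta> x) = cpoly_class (P_poly \<delta> d x)"
proof -
  interpret lnd \<delta> using assms(1,2) by unfold_locales
  define v where "v l j = ceval x ((\<delta> ^^ l) (coord j))" for l j
  have v_Some: "v l (Some k) = ceval x ((\<delta> ^^ l) (cvar k))" for l k
    by (simp add: v_def coord_def)
  have v_None: "v l None = (if l = 0 then 1 else 0)" for l
    using iter_cconst[of l 1] by (simp add: v_def coord_def cconst_def)
  have exp_Some: "exp_poly d (\<lambda>l. v l (Some k)) = orbit_poly x (cvar k)" for k
    by (simp add: orbit_poly_cvar v_Some assms(4))
  obtain k where k: "ceval x ((\<delta> ^^ d) (cvar k)) \<noteq> 0" using assms(5) by blast
  interpret poly_curve d v None
  proof
    show "d > 0" using lnd_degree_pos assms(3,4) by simp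
    show "v 0 None = 1" by (simp add: v_None)
    show "v l None = 0" if "l > 0" for l using that by (simp add: v_None)
    show "v l = (\<lambda>_. 0)" if l: "l > d" for l
    proof
      fix j
      show "v l j = 0"
      proof (cases j)
        case None
        then show ?thesis using l by (simp add: v_None)
      next
        case (Some i)
        have "(\<delta> ^^ l) (cvar i) = 0"
          using iter_eq_0_mono[OF funpow_lnd_degree] l assms(4) by simp
        then show ?thesis by (simp add: Some v_Some)
      qed
    qed
    show "v d \<noteq> (\<lambda>_. 0)" using k v_Some[of d k] by auto
    show "inj (\<lambda>t j. poly (exp_poly d (\<lambda>l. v l j)) t)"
    proof (rule injI)
      fix s t assume "(\<lambda>j. poly (exp_poly d (\<lambda>l. v l j)) s) = (\<lambda>j. poly (exp_poly d (\<lambda>l. v l j)) t)"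
      then have "poly (orbit_poly x (cvar j)) s = poly (orbit_poly x (cvar j)) t" for j
        by (auto simp flip: exp_Some dest: fun_cong[of _ _ "Some j"])
      then show "s = t" using orbit_inj lnd_degree_pos assms(3,4) k by blast
    qed
  qed
  \<comment> \<open>The sign convention of the action reverses the parameter, which does not change
    the orbit as a set.\<close>
  have "affine_embed (lnd_action \<delta> t x) = proj_pt (\<gamma> (- t))" for t
  proof -
    have "case_option 1 (lnd_action \<delta> t x) = \<gamma> (- t)"
    proof
      fix j
      show "case_option 1 (lnd_action \<delta> t x) j = \<gamma> (- t) j"
        using \<gamma>_o by (cases j) (simp_all add: lnd_action_eq \<gamma>_def exp_Some)
    qed
    then show ?thesis by (simp add: affine_embed_def)
  qed
  then have "affine_embed ` range (\<lambda>t. lnd_action \<delta> t x) = (\<lambda>t. proj_pt (\<gamma> t)) ` range uminus"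
    by (simp only: image_image)
  then have "orbit_closure \<delta> x = curve"
    unfolding orbit_closure_def closure_curve[symmetric] by simp
  \<comment> \<open>\<open>F_entry\<close> is \<open>bez_entry\<close> for the sequences
    \<open>alpha_form\<close> and \<open>beta_form\<close>, so the definitions unfold to the same
    determinant.\<close>
  moreover have "P_poly \<delta> d x = chow_form"
    by (simp add: P_poly_def chow_form_def bez_det_def F_entry_def bez_entry_def f_entry_def
        alpha_form_def beta_form_def v_def)
  ultimately show ?thesis using chow_point_curve by simp
qed

end
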